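(* Let $\mathbb{k}$ be a field and let $p,q\in\mathbb{k}^*$ with $pq\neq 1$ be primitive $m$-th and $n$-th roots of unity, respectively. Then the PI degree of the algebra $\mathcal{H}_{p,q}$ is $\operatorname{PI-deg}(\mathcal{H}_{p,q})=l$, where $l=\operatorname{lcm}(m,n)$.
   Context: $\mathbb{k}$ is a field of arbitrary characteristic and $\mathbb{k}^*=\mathbb{k}\setminus\{0\}$. For $p,q\in\mathbb{k}^*$, $\mathcal{H}_{p,q}$ is the (unital associative) $\mathbb{k}$-algebra generated by $x,y,z$ subject to the relations $zx=p^{-1}xz$, $zy=pyz$, $yx-qxy=z$. It is a prime (indeed a domain) affine Noetherian algebra, and it is a polynomial identity (PI) algebra when $p,q$ are roots of unity with $pq\neq1$. The minimal degree $d$ of a PI ring is the least degree of all its monic polynomial identities (in noncommuting variables with integer coefficients), and the PI degree of a prime PI ring $A$ with minimal degree $d$ is $\operatorname{PI-deg}(A)=d/2$; equivalently, if $Z(A)$ is the center of $A$, $F$ its fraction field and $Q=A\,(Z(A)\setminus\{0\})^{-1}$, then $\dim_F Q=\operatorname{PI-deg}(A)^2$. *)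

theory Defs
  imports
    "HOL-Algebra.Algebra"
    "HOL-Algebra.Algebraic_Closure_Type"
    "HOL-Library.Poly_Mapping"
begin

section \<open>Free algebras\<close>

text \<open>
  The free monoid is written additively, because Poly_Mapping turns finitely supported functions
  on an additive (not necessarily commutative) monoid into the convolution (monoid) algebra.
\<close>

datatype 'x free_word = Word (letters: "'x list")

instantiation free_word :: (type) monoid_add
begin

definition zero_free_word :: "'x free_word"
  where "zero_free_word = Word []"

definition plus_free_word :: "'x free_word \<Rightarrow> 'x free_word \<Rightarrow> 'x free_word"
  where "plus_free_word u v = Word (letters u @ letters v)"

instance
  by standard (simp_all add: zero_free_word_def plus_free_word_def)

end

type_synonym ('x, 'k) free_alg = "'x free_word \<Rightarrow>\<^sub>0 'k"

definition gen :: "'x \<Rightarrow> ('x, 'k::ring_1) free_alg"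
  where "gen v = Poly_Mapping.single (Word [v]) 1"

definition scalar :: "'k \<Rightarrow> ('x, 'k::ring_1) free_alg"
  where "scalar c = Poly_Mapping.single 0 c"

section \<open>The algebra \<open>H\<^sub>p\<^sub>,\<^sub>q\<close>\<close>

datatype xyz = Gx | Gy | Gz

definition H_relations :: "'k::field \<Rightarrow> 'k \<Rightarrow> (xyz, 'k) free_alg set"
  where "H_relations p q =
   {gen Gz * gen Gx - scalar (inverse p) * (gen Gx * gen Gz),
    gen Gz * gen Gy - scalar p * (gen Gy * gen Gz),
    gen Gy * gen Gx - scalar q * (gen Gx * gen Gy) - gen Gz}"

text \<open>
  The two-sided ideal below absorbs scalars, being an ideal of a unital algebra, so the quotient
  ring is the ring underlying the \<open>k\<close>-algebra with the given presentation. Polynomial identities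
  have integer coefficients, so this ring structure is all that the PI degree sees.
\<close>

definition H_alg :: "'k::field \<Rightarrow> 'k \<Rightarrow> (xyz, 'k) free_alg set ring"
  where "H_alg p q =
    ring_of_type_algebra Quot (Idl\<^bsub>ring_of_type_algebra\<^esub> (H_relations p q))"

lemma ring_ring_of_type_algebra: "ring (ring_of_type_algebra :: 'a::ring_1 ring)"
proof -
  have "\<exists>y. x + y = 0" for x :: 'a
    using add.right_inverse by blast
  thus ?thesis
    unfolding ring_of_type_algebra_def using add.right_inverse
    by unfold_locales (auto simp: algebra_simps Units_def)
qed

lemma ring_H_alg: "ring (H_alg p q)"
proof -
  interpret ring "ring_of_type_algebra :: (xyz, 'a) free_alg ring"
    by (rule ring_ring_of_type_algebra)
  have "ideal (Idl\<^bsub>ring_of_type_algebra\<^esub> (H_relations p q)) ring_of_type_algebra"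
    by (rule genideal_ideal) (simp add: ring_of_type_algebra_def)
  thus ?thesis
    unfolding H_alg_def by (rule ideal.quotient_is_ring)
qed

section \<open>Polynomial identities and the PI degree\<close>

type_synonym nc_poly = "(nat, int) free_alg"

definition nc_eval :: "('a, 'b) ring_scheme \<Rightarrow> (nat \<Rightarrow> 'a) \<Rightarrow> nc_poly \<Rightarrow> 'a"
  where "nc_eval R a f =
    (\<Oplus>\<^bsub>R\<^esub>w\<in>Poly_Mapping.keys f.
       [Poly_Mapping.lookup f w] \<cdot>\<^bsub>R\<^esub> foldr (\<otimes>\<^bsub>R\<^esub>) (map a (letters w)) \<one>\<^bsub>R\<^esub>)"

definition poly_identity :: "('a, 'b) ring_scheme \<Rightarrow> nc_poly \<Rightarrow> bool"
  where "poly_identity R f \<longleftrightarrow>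
    (\<forall>a. (\<forall>i. a i \<in> carrier R) \<longrightarrow> nc_eval R a f = \<zero>\<^bsub>R\<^esub>)"

definition nc_degree :: "nc_poly \<Rightarrow> nat"
  where "nc_degree f = Max ((\<lambda>w. length (letters w)) ` Poly_Mapping.keys f)"

text \<open>
  Monic in the usual sense of PI theory: some (not necessarily unique) monomial of highest total
  degree has coefficient 1. In particular a monic polynomial is nonzero.
\<close>

definition nc_monic :: "nc_poly \<Rightarrow> bool"
  where "nc_monic f \<longleftrightarrow>
    (\<exists>w. length (letters w) = nc_degree f \<and> Poly_Mapping.lookup f w = 1)"

definition PI_ring :: "('a, 'b) ring_scheme \<Rightarrow> bool"
  where "PI_ring R \<longleftrightarrow> (\<exists>f. nc_monic f \<and> poly_identity R f)"

definition min_degree :: "('a, 'b) ring_scheme \<Rightarrow> nat"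
  where "min_degree R = (LEAST d. \<exists>f. nc_monic f \<and> poly_identity R f \<and> nc_degree f = d)"

text \<open>
  Meant for prime PI rings. The value is rational so that halving loses nothing, and the value 0
  for rings that are not PI ensures that a positive PI degree entails being PI.
\<close>

definition PI_degree :: "('a, 'b) ring_scheme \<Rightarrow> rat"
  where "PI_degree R = (if PI_ring R then of_nat (min_degree R) / 2 else 0)"

section \<open>Primitive roots of unity\<close>

definition primitive_root_of_unity :: "nat \<Rightarrow> 'k::field \<Rightarrow> bool"
  where "primitive_root_of_unity m p \<longleftrightarrow>
    m > 0 \<and> p ^ m = 1 \<and> (\<forall>j. 0 < j \<and> j < m \<longrightarrow> p ^ j \<noteq> 1)"

end

theory Submission
  imports Defs
begin

text \<open>
  Upper bound: for \<open>l = lcm m n\<close> the algebra has a faithful representation by \<open>l \<times> l\<close> matrices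
  over the commutative ring \<open>k[S,Z,D]\<close>: with indices modulo \<open>l\<close>, \<open>x\<close> sends \<open>v\<^sub>i\<close> to
  \<open>S v\<^sub>i\<^sub>+\<^sub>1\<close>, \<open>z\<close> scales \<open>v\<^sub>i\<close> by \<open>p\<^sup>-\<^sup>i S Z\<close>, and \<open>y\<close> sends \<open>v\<^sub>i\<close> to
  \<open>(q\<^sup>i D + [i] Z) v\<^sub>i\<^sub>-\<^sub>1\<close>, where \<open>[i] = (q\<^sup>i - p\<^sup>-\<^sup>i) / (q - p\<^sup>-\<^sup>1)\<close>. By the Amitsur-Levitzki theorem the
  standard polynomial of degree \<open>2l\<close> is therefore an identity.

  Lower bound: at \<open>S = Z = 1\<close>, \<open>D = 0\<close> the image contains nonzero multiples of all matrix units over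
  \<open>k\<close>, because the pairs \<open>(q\<^sup>i, p\<^sup>-\<^sup>i)\<close> are distinct modulo \<open>l\<close>. Polarizing an identity of degree
  less than \<open>2l\<close> and substituting a staircase of matrix units leaves a single nonzero term.

  Amitsur-Levitzki follows Razmyslov and Procesi: antisymmetrizing the indices of more than \<open>n\<close>
  matrices of size \<open>n\<close> gives zero; expanding over permutations, those in which some cycle avoids the
  marked matrix vanish, since traces of even standard polynomials do, and the remaining ones all
  contribute the same term.
\<close>

section \<open>The Amitsur-Levitzki theorem\<close>

lemma sign_cycle_of_list:
  "distinct cs \<Longrightarrow> sign (cycle_of_list cs) = (- 1) ^ (length cs - 1)"
proof (induction cs rule: cycle_of_list.induct)
  case (1 i j cs)
  then show ?case
    using sign_compose[OF permutation_swap_id[of i j] permutation_of_cycle[of "j # cs"]]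
    by (simp add: sign_swap_id o_def)
qed auto

text \<open>Summed over \<open>w\<close>, this is the product, over the cycles of
  \<open>\<theta>\<close>, of the traces of the matrix products read along each cycle, position
  \<open>a\<close> holding the matrix \<open>B (\<tau> a)\<close>.\<close>

definition cyc_weight :: "nat \<Rightarrow> (nat \<Rightarrow> nat \<Rightarrow> nat \<Rightarrow> int) \<Rightarrow> (nat \<Rightarrow> nat) \<Rightarrow> (nat \<Rightarrow> nat) \<Rightarrow> (nat \<Rightarrow> nat) \<Rightarrow> int"
  where "cyc_weight N B \<theta> \<tau> w = (\<Prod>a\<le>N. B (\<tau> a) (w a) (w (\<theta> a)))"

text \<open>The coefficient of the permutation \<open>\<theta>\<close> in the antisymmetrized trace identity; the matrix
  \<open>B N\<close> stays in place.\<close>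

definition alt_trace :: "nat \<Rightarrow> nat \<Rightarrow> (nat \<Rightarrow> nat \<Rightarrow> nat \<Rightarrow> int) \<Rightarrow> (nat \<Rightarrow> nat) \<Rightarrow> int"
  where "alt_trace n N B \<theta> = (\<Sum>\<tau> | \<tau> permutes {..<N}. sign \<tau> *
      (\<Sum>w\<in>{..N} \<rightarrow>\<^sub>E {..<n}. cyc_weight N B \<theta> \<tau> w))"

text \<open>Both \<open>\<tau>\<close> and \<open>w\<close> are reindexed by composition with
  \<open>\<pi>\<close>; since \<open>\<pi>\<close> fixes \<open>N\<close>, the marked matrix stays
  put. The case \<open>\<theta>' = \<theta>\<close> makes terms vanish, and the general case
  compares full cycles with \<open>succ_cycle\<close>.\<close>

lemma alt_trace_conj:
  assumes \<pi>: "\<pi> permutes {..<N}" and \<theta>: "\<theta> permutes {..N}"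
    and comm: "\<And>a. a \<le> N \<Longrightarrow> \<pi> (\<theta> a) = \<theta>' (\<pi> a)"
  shows "alt_trace n N B \<theta> = sign \<pi> * alt_trace n N B \<theta>'"
proof -
  have \<pi>N: "\<pi> permutes {..N}"
    by (rule permutes_subset[OF \<pi>]) auto
  have w: "(\<Sum>w\<in>{..N} \<rightarrow>\<^sub>E {..<n}. cyc_weight N B \<theta> (\<tau> \<circ> \<pi>) w)
      = (\<Sum>w\<in>{..N} \<rightarrow>\<^sub>E {..<n}. cyc_weight N B \<theta>' \<tau> w)" (is "?L = ?R") for \<tau>
  proof -
    have "?L = (\<Sum>w\<in>{..N} \<rightarrow>\<^sub>E {..<n}. cyc_weight N B \<theta> (\<tau> \<circ> \<pi>) (w \<circ> \<pi>))"
    proof (rule sum.reindex_bij_witness[of _ "\<lambda>w. w \<circ> \<pi>" "\<lambda>w. w \<circ> inv_into UNIV \<pi>"])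
      fix w :: "nat \<Rightarrow> nat" assume w: "w \<in> {..N} \<rightarrow>\<^sub>E {..<n}"
      show "w \<circ> inv_into UNIV \<pi> \<circ> \<pi> = w" "w \<circ> \<pi> \<circ> inv_into UNIV \<pi> = w"
        using permutes_inv_o[OF \<pi>] by (simp_all add: comp_assoc)
      show "w \<circ> inv_into UNIV \<pi> \<in> {..N} \<rightarrow>\<^sub>E {..<n}" "w \<circ> \<pi> \<in> {..N} \<rightarrow>\<^sub>E {..<n}"
        using w permutes_in_image[OF \<pi>N] permutes_in_image[OF permutes_inv[OF \<pi>N]]
          permutes_not_in[OF \<pi>N] permutes_not_in[OF permutes_inv[OF \<pi>N]]
        by (auto simp: PiE_iff extensional_def)
      show "cyc_weight N B \<theta> (\<tau> \<circ> \<pi>) (w \<circ> inv_into UNIV \<pi> \<circ> \<pi>) = cyc_weight N B \<theta> (\<tau> \<circ> \<pi>) w"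
        using permutes_inv_o[OF \<pi>] by (simp add: comp_assoc)
    qed
    also have "\<dots> = ?R"
    proof (rule sum.cong[OF refl])
      fix w :: "nat \<Rightarrow> nat"
      have "cyc_weight N B \<theta> (\<tau> \<circ> \<pi>) (w \<circ> \<pi>) = (\<Prod>a\<le>N. B (\<tau> (\<pi> a)) (w (\<pi> a)) (w (\<theta>' (\<pi> a))))"
        unfolding cyc_weight_def by (rule prod.cong) (auto simp: comm)
      also have "\<dots> = cyc_weight N B \<theta>' \<tau> w"
        unfolding cyc_weight_def
        using prod.permute[OF \<pi>N, of "\<lambda>b. B (\<tau> b) (w b) (w (\<theta>' b))"] by (simp add: o_def)
      finally show "cyc_weight N B \<theta> (\<tau> \<circ> \<pi>) (w \<circ> \<pi>) = cyc_weight N B \<theta>' \<tau> w" .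
    qed
    finally show ?thesis .
  qed
  have perm: "permutation \<tau>" if "\<tau> permutes {..<N}" for \<tau>
    using that permutation_permutes by blast
  have "alt_trace n N B \<theta> = (\<Sum>\<tau> | \<tau> permutes {..<N}. sign (\<tau> \<circ> \<pi>) *
      (\<Sum>w\<in>{..N} \<rightarrow>\<^sub>E {..<n}. cyc_weight N B \<theta> (\<tau> \<circ> \<pi>) w))"
    unfolding alt_trace_def by (rule sum_permutations_compose_right[OF \<pi>])
  also have "\<dots> = (\<Sum>\<tau> | \<tau> permutes {..<N}. sign \<pi> * (sign \<tau> *
      (\<Sum>w\<in>{..N} \<rightarrow>\<^sub>E {..<n}. cyc_weight N B \<theta>' \<tau> w)))"
    by (rule sum.cong) (auto simp: w sign_compose perm \<pi>)
  finally show ?thesis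
    by (simp add: alt_trace_def sum_distrib_left)
qed

text \<open>Such a \<open>\<theta>\<close> encodes an arbitrary permutation of \<open>n + 1\<close> blocks, the \<open>n\<close> products of the
  matrices in positions \<open>2i\<close> and \<open>2i+1\<close> and the single matrix in position \<open>2n\<close>.\<close>

definition pair_perms :: "nat \<Rightarrow> (nat \<Rightarrow> nat) set"
  where "pair_perms n = {\<theta>. \<theta> permutes {..2 * n} \<and> (\<forall>i<n. \<theta> (2 * i) = 2 * i + 1)}"

lemma finite_pair_perms: "finite (pair_perms n)"
  by (rule finite_subset[OF _ finite_permutations[of "{..2*n}"]]) (auto simp: pair_perms_def)

text \<open>By the pigeonhole principle \<open>w\<close> takes the same value at two of the \<open>n + 1\<close> even positions, and
  swapping these reverses the sign.\<close>

lemma alternating_pair_perms_sum: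
  assumes w: "w \<in> {..2 * n} \<rightarrow>\<^sub>E {..<n}"
  shows "(\<Sum>\<theta>\<in>pair_perms n. sign \<theta> * cyc_weight (2 * n) B \<theta> \<tau> w) = 0" (is "?S = 0")
proof -
  have "\<not> inj_on (\<lambda>i. w (2 * i)) {..n}"
  proof
    assume "inj_on (\<lambda>i. w (2 * i)) {..n}"
    moreover have "(\<lambda>i. w (2 * i)) ` {..n} \<subseteq> {..<n}"
      using w by (auto simp: PiE_iff Pi_iff)
    ultimately have "card {..n} \<le> card {..<n}"
      by (intro card_inj_on_le) auto
    then show False by simp
  qed
  then obtain i j where ij: "i \<le> n" "j \<le> n" "i \<noteq> j" "w (2 * i) = w (2 * j)"
    by (auto simp: inj_on_def)
  define t where "t = transpose (2 * i) (2 * j)"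
  have t: "t permutes {..2 * n}"
    unfolding t_def using ij by (intro permutes_swap_id) auto
  have tt: "t \<circ> t = id" "t (t a) = a" for a by (auto simp: t_def)
  have wt: "w (t a) = w a" for a
    using ij by (auto simp: t_def transpose_def)
  have todd: "t (Suc (2 * a)) = Suc (2 * a)" for a
    unfolding t_def by (rule transpose_apply_other) presburger+
  have mem: "t \<circ> \<theta> \<in> pair_perms n" if "\<theta> \<in> pair_perms n" for \<theta>
    using that permutes_compose[OF _ t] by (auto simp: pair_perms_def todd)
  have "?S = (\<Sum>\<theta>\<in>pair_perms n. sign (t \<circ> \<theta>) * cyc_weight (2 * n) B (t \<circ> \<theta>) \<tau> w)"
    by (rule sum.reindex_bij_witness[of _ "\<lambda>\<theta>. t \<circ> \<theta>" "\<lambda>\<theta>. t \<circ> \<theta>"])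
      (auto simp: mem fun_eq_iff tt comp_assoc[symmetric])
  also have "\<dots> = (\<Sum>\<theta>\<in>pair_perms n. - (sign \<theta> * cyc_weight (2 * n) B \<theta> \<tau> w))"
  proof (rule sum.cong[OF refl])
    fix \<theta> assume "\<theta> \<in> pair_perms n"
    then have "permutation \<theta>"
      by (auto simp: pair_perms_def permutation_permutes)
    then have "sign (t \<circ> \<theta>) = - sign \<theta>"
      using ij by (simp add: t_def sign_compose permutation_swap_id sign_swap_id)
    then show "sign (t \<circ> \<theta>) * cyc_weight (2 * n) B (t \<circ> \<theta>) \<tau> w
      = - (sign \<theta> * cyc_weight (2 * n) B \<theta> \<tau> w)"
      by (simp add: cyc_weight_def wt)
  qed
  also have "\<dots> = - ?S" by (simp add: sum_negf)
  finally show ?thesis by simp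
qed

lemma pair_perms_alt_trace_sum:
  "(\<Sum>\<theta>\<in>pair_perms n. sign \<theta> * alt_trace n (2 * n) B \<theta>) = 0"
proof -
  have "(\<Sum>\<theta>\<in>pair_perms n. sign \<theta> * alt_trace n (2 * n) B \<theta>)
    = (\<Sum>\<tau> | \<tau> permutes {..<2*n}. \<Sum>w\<in>{..2*n} \<rightarrow>\<^sub>E {..<n}. sign \<tau> *
        (\<Sum>\<theta>\<in>pair_perms n. sign \<theta> * cyc_weight (2 * n) B \<theta> \<tau> w))"
    unfolding alt_trace_def sum_distrib_left
    by (subst sum.swap, rule sum.cong[OF refl], subst sum.swap) (simp add: ac_simps)
  also have "\<dots> = 0"
    by (simp add: alternating_pair_perms_sum)
  finally show ?thesis .
qed

section \<open>Cycle structure of the block permutations\<close>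

lemma odd_leE:
  assumes "odd (x :: nat)" "x \<le> 2 * n"
  obtains i where "i < n" "x = 2 * i + 1"
proof -
  from assms(1) obtain i where "x = 2 * i + 1" by (rule oddE)
  with assms(2) that[of i] show ?thesis by simp
qed

text \<open>The odd values up to \<open>2 * n\<close> are all taken by even positions below
  \<open>2 * n\<close>, so by injectivity an odd position has an even image.\<close>

lemma pair_perms_parity:
  assumes \<theta>: "\<theta> \<in> pair_perms n" and a: "a < 2 * n"
  shows "even (\<theta> a) = odd a"
proof (cases "even a")
  case True
  then obtain i where "a = 2 * i" by blast
  then show ?thesis using assms by (simp add: pair_perms_def)
next
  case False
  have perm: "\<theta> permutes {..2*n}" and pr: "\<And>i. i < n \<Longrightarrow> \<theta> (2 * i) = 2 * i + 1"
    using \<theta> by (auto simp: pair_perms_def)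
  have "\<theta> a \<le> 2 * n" using permutes_in_image[OF perm, of a] a by simp
  moreover have "\<theta> a \<noteq> 2 * i + 1" if "i < n" for i
  proof
    assume "\<theta> a = 2 * i + 1"
    then have "\<theta> a = \<theta> (2 * i)" using pr[OF that] by simp
    then have "a = 2 * i" by (rule injD[OF permutes_inj[OF perm]])
    then show False using False by simp
  qed
  ultimately have "even (\<theta> a)"
    using odd_leE by blast
  then show ?thesis using False by simp
qed

lemma pair_perms_parity_last:
  assumes \<theta>: "\<theta> \<in> pair_perms n"
  shows "even (\<theta> (2 * n))"
proof -
  have perm: "\<theta> permutes {..2*n}" and pr: "\<And>i. i < n \<Longrightarrow> \<theta> (2 * i) = 2 * i + 1"
    using \<theta> by (auto simp: pair_perms_def)
  have "\<theta> (2 * n) \<le> 2 * n" using permutes_in_image[OF perm, of "2*n"] by simp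
  moreover have "\<theta> (2 * n) \<noteq> 2 * i + 1" if "i < n" for i
  proof
    assume "\<theta> (2 * n) = 2 * i + 1"
    then have "\<theta> (2 * n) = \<theta> (2 * i)" using pr[OF that] by simp
    then have "2 * n = 2 * i" by (rule injD[OF permutes_inj[OF perm]])
    then show False using that by simp
  qed
  ultimately show ?thesis
    using odd_leE by blast
qed

text \<open>On the cycle of \<open>x\<close>, which \<open>p\<close> preserves, both maps agree; off
  it the list cycle is the identity.\<close>

lemma cycle_of_list_support_commute:
  assumes "permutation p"
  shows "cycle_of_list (support p x) (p a) = p (cycle_of_list (support p x) a)"
proof -
  have p: "p b = cycle_of_list (support p x) b" if "b \<in> set (support p x)" for b
    using cycle_restrict[OF assms that] .
  have img: "p ` set (support p x) = set (support p x)"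
    using cycle_is_surj[OF cycle_of_permutation[OF assms, of x]] p
    by (metis (no_types, lifting) image_cong)
  show ?thesis
  proof (cases "a \<in> set (support p x)")
    case True
    then have "p a \<in> set (support p x)" using img by blast
    then show ?thesis using p[OF True] p by metis
  next
    case False
    have "inj p" using assms permutation_bijective bij_is_inj by blast
    then have "p a \<notin> set (support p x)" using False img
      by (metis inj_image_mem_iff)
    then show ?thesis using False id_outside_supp by metis
  qed
qed

text \<open>A cycle of \<open>\<theta>\<close> avoiding \<open>2n\<close> has even length, hence is odd, and it commutes with \<open>\<theta>\<close>.\<close>

lemma alt_trace_not_full:
  assumes \<theta>: "\<theta> \<in> pair_perms n" and a: "a \<le> 2 * n" "\<And>k. (\<theta> ^^ k) a \<noteq> 2 * n"
  shows "alt_trace n (2 * n) B \<theta> = 0"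
proof -
  have perm: "\<theta> permutes {..2*n}" using \<theta> by (auto simp: pair_perms_def)
  then have pm: "permutation \<theta>" by (auto simp: permutation_permutes)
  define cs where "cs = support \<theta> a"
  define L where "L = least_power \<theta> a"
  have L: "(\<theta> ^^ L) a = a" "L > 0"
    using least_power_of_permutation[OF pm, of a] by (auto simp: L_def)
  have lt: "(\<theta> ^^ k) a < 2 * n" for k
    using a(1) a(2)[of k] permutes_in_image[OF permutes_funpow[OF perm], of k a] by simp
  \<comment> \<open>The orbit avoids \<open>2 * n\<close>, so parity alternates along it, and the
    return to \<open>a\<close> after \<open>L\<close> steps makes \<open>L\<close> even.\<close>
  have par: "even ((\<theta> ^^ k) a) = even (a + k)" for k
    by (induction k) (auto simp: pair_perms_parity[OF \<theta> lt])
  have "even L" using par[of L] L(1) by simp presburger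
  have "distinct cs" unfolding cs_def by (rule cycle_of_permutation[OF pm])
  then have "sign (cycle_of_list cs) = (-1) ^ (L - 1)"
    by (simp add: sign_cycle_of_list cs_def L_def)
  also have "\<dots> = -1" using \<open>even L\<close> L by (simp add: uminus_power_if)
  finally have sg: "sign (cycle_of_list cs) = -1" .
  have "cycle_of_list cs permutes {..<2*n}"
    by (rule permutes_subset[OF cycle_permutes]) (auto simp: cs_def lt)
  \<comment> \<open>Conjugation by an odd permutation that commutes with \<open>\<theta>\<close>
    shows that the integer is its own negative.\<close>
  from alt_trace_conj[OF this perm, of \<theta> n B] show ?thesis
    using cycle_of_list_support_commute[OF pm] sg by (auto simp: cs_def)
qed

text \<open>For this cycle \<open>alt_trace n N B\<close> is the trace of the standard polynomial in
  \<open>B 0\<close>, ..., \<open>B (N - 1)\<close>, multiplied by \<open>B N\<close>.\<close>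

definition succ_cycle :: "nat \<Rightarrow> nat \<Rightarrow> nat"
  where "succ_cycle N a = (if a < N then Suc a else if a = N then 0 else a)"

lemma permutesI_finite:
  assumes "finite A" "\<And>a. a \<in> A \<Longrightarrow> f a \<in> A" "inj_on f A" "\<And>a. a \<notin> A \<Longrightarrow> f a = a"
  shows "f permutes A"
proof (rule bij_imp_permutes)
  show "bij_betw f A A"
    using assms by (simp add: bij_betw_def endo_inj_surj image_subsetI)
qed (use assms in auto)

lemma succ_cycle_permutes: "succ_cycle N permutes {..N}"
  by (rule permutesI_finite) (auto simp: succ_cycle_def inj_on_def split: if_splits)

lemma succ_cycle_in_pair_perms: "succ_cycle (2 * n) \<in> pair_perms n"
  by (auto simp: pair_perms_def succ_cycle_permutes) (auto simp: succ_cycle_def)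

text \<open>The restrictions of \<open>\<kappa>\<close> to the even and to the odd numbers are conjugate.\<close>

lemma sign_block_permutation:
  fixes \<kappa> :: "nat \<Rightarrow> nat"
  assumes \<kappa>: "\<kappa> permutes {..<2 * n}"
    and nc_subst: "\<And>a. a < 2 * n \<Longrightarrow> even a \<Longrightarrow> even (\<kappa> a)"
    and pr: "\<And>a. a < 2 * n \<Longrightarrow> even a \<Longrightarrow> \<kappa> (Suc a) = Suc (\<kappa> a)"
  shows "sign \<kappa> = 1"
proof -
  define E where "E a = (if even a then \<kappa> a else a)" for a
  \<comment> \<open>\<open>\<delta>\<close> swaps \<open>2 * i\<close> and \<open>2 * i + 1\<close>,
    so it conjugates \<open>E\<close>, the even part of \<kappa>, to the odd part; both signs then
    occur twice in \<open>sign \<kappa>\<close>.\<close>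
  define \<delta> where "\<delta> a = (if a < 2 * n then (if even a then a + 1 else a - 1) else a)" for a
  have lt: "\<kappa> a < 2 * n \<longleftrightarrow> a < 2 * n" for a using permutes_in_image[OF \<kappa>, of a] by simp
  have out: "\<kappa> a = a" if "\<not> a < 2 * n" for a using permutes_not_in[OF \<kappa>, of a] that by simp
  have E: "E permutes {..<2*n}"
  proof (rule permutesI_finite)
    show "inj_on E {..<2*n}"
      by (rule inj_onI) (auto simp: E_def dest: nc_subst injD[OF permutes_inj[OF \<kappa>]] split: if_splits)
  qed (auto simp: E_def lt out)
  have \<delta>: "\<delta> permutes {..<2*n}"
  proof (rule permutesI_finite)
    show "inj_on \<delta> {..<2*n}"
      by (rule inj_onI) (simp add: \<delta>_def split: if_splits, presburger+)
  next
    fix a assume "a \<in> {..<2*n}"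
    then show "\<delta> a \<in> {..<2*n}" by (simp add: \<delta>_def) presburger
  qed (auto simp: \<delta>_def)
  have "\<kappa> a = (E \<circ> (\<delta> \<circ> (E \<circ> \<delta>))) a" for a
  proof (cases "a < 2 * n")
    case True
    show ?thesis
    proof (cases "even a")
      case True': True
      have "Suc a < 2 * n" using True True' by (auto elim!: evenE)
      then show ?thesis using True True' by (simp add: E_def \<delta>_def)
    next
      case False
      then obtain b where b: "a = Suc b" "even b" by (cases a) auto
      have "\<kappa> b < 2 * n" "even (\<kappa> b)" using b True lt[of b] nc_subst[of b] by auto
      then show ?thesis using b True pr[of b] by (simp add: E_def \<delta>_def)
    qed
  next
    case False
    then show ?thesis by (simp add: E_def \<delta>_def out)
  qed
  then have eq: "\<kappa> = E \<circ> (\<delta> \<circ> (E \<circ> \<delta>))" by blast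
  have "permutation E" "permutation \<delta>" using E \<delta> permutation_permutes by blast+
  then have "sign \<kappa> = sign E * (sign \<delta> * (sign E * sign \<delta>))"
    unfolding eq by (simp add: sign_compose permutation_compose)
  then show ?thesis
    by (cases E rule: sign_cases; cases \<delta> rule: sign_cases) simp_all
qed

text \<open>Such a \<theta> is one cycle of odd length \<open>2 * n + 1\<close>, hence even. It is
  conjugate to \<open>succ_cycle\<close> by a permutation that fixes \<open>2 * n\<close> and moves
  whole blocks, hence is even as well.\<close>

lemma pair_perms_full:
  assumes \<theta>: "\<theta> \<in> pair_perms n" and full: "\<And>a. a \<le> 2 * n \<Longrightarrow> \<exists>k. (\<theta> ^^ k) a = 2 * n"
  shows "sign \<theta> = 1" and "alt_trace n (2 * n) B \<theta> = alt_trace n (2 * n) B (succ_cycle (2 * n))"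
proof -
  define N where "N = 2 * n"
  have perm: "\<theta> permutes {..N}" using \<theta> by (auto simp: pair_perms_def N_def)
  then have pm: "permutation \<theta>" by (auto simp: permutation_permutes)
  define cs where "cs = support \<theta> N"
  have dist: "distinct cs" unfolding cs_def by (rule cycle_of_permutation[OF pm])
  have set_cs: "set cs = {..N}"
  proof
    show "set cs \<subseteq> {..N}"
      using permutes_in_image[OF permutes_funpow[OF perm]] by (auto simp: cs_def)
  next
    show "{..N} \<subseteq> set cs"
    proof
      fix a assume "a \<in> {..N}"
      then obtain k where k: "(\<theta> ^^ k) a = N" using full by (auto simp: N_def)
      obtain m where m: "\<theta> ^^ m = id" "m > k"
        using permutation_is_nilpotent'[OF pm] .
      have "(\<theta> ^^ (m - k)) N = (\<theta> ^^ (m - k + k)) a"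
        using k by (metis comp_apply funpow_add)
      then have "(\<theta> ^^ (m - k)) N = a" using m by simp
      then have "a \<in> range (\<lambda>i. (\<theta> ^^ i) N)" by (metis rangeI)
      then show "a \<in> set cs"
        unfolding cs_def using support_set[OF pm, of N] by simp
    qed
  qed
  have len: "length cs = Suc N"
    using distinct_card[OF dist] set_cs by simp
  then have lp: "least_power \<theta> N = Suc N" by (simp add: cs_def)
  have cyc: "(\<theta> ^^ Suc N) N = N"
    using least_power_of_permutation(1)[OF pm, of N] lp by simp
  have "\<theta> = cycle_of_list cs"
  proof
    fix a show "\<theta> a = cycle_of_list cs a"
    proof (cases "a \<le> N")
      case True
      then show ?thesis using cycle_restrict[OF pm, of a N] set_cs by (simp add: cs_def)
    next
      case False
      then show ?thesis using id_outside_supp[of a cs] set_cs permutes_not_in[OF perm] by simp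
    qed
  qed
  then show "sign \<theta> = 1" using sign_cycle_of_list[OF dist] len by (simp add: N_def)
  \<comment> \<open>\<kappa> lists the positions in the order in which \<theta> visits them after
    \<open>N\<close>. The shift by one lets \<open>N\<close> stay fixed and makes \<kappa> preserve
    parity.\<close>
  define \<kappa> where "\<kappa> b = (if b < N then (\<theta> ^^ Suc b) N else b)" for b
  have inj: "i = j" if "(\<theta> ^^ i) N = (\<theta> ^^ j) N" "i < Suc N" "j < Suc N" for i j
  proof -
    have "cs ! i = cs ! j" using that by (simp add: cs_def lp del: upt_Suc)
    then show ?thesis using nth_eq_iff_index_eq[OF dist] len that by simp
  qed
  have lt: "(\<theta> ^^ Suc b) N < N" if "b < N" for b
  proof -
    have "(\<theta> ^^ Suc b) N \<le> N"
      using permutes_in_image[OF permutes_funpow[OF perm], of "Suc b" N] by simp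
    moreover have "(\<theta> ^^ Suc b) N \<noteq> (\<theta> ^^ 0) N"
      using inj[of "Suc b" 0] that by auto
    ultimately show ?thesis by simp
  qed
  have \<kappa>: "\<kappa> permutes {..<N}"
  proof (rule permutesI_finite)
    show "inj_on \<kappa> {..<N}"
      using inj by (auto simp: inj_on_def \<kappa>_def simp del: funpow.simps)
  qed (auto simp: \<kappa>_def lt simp del: funpow.simps)
  have par: "even ((\<theta> ^^ Suc b) N) = even b" if "b < N" for b
    using that
  proof (induction b)
    case 0
    then show ?case using pair_perms_parity_last[OF \<theta>] by (simp add: N_def)
  next
    case (Suc b)
    then have "even (\<theta> ((\<theta> ^^ Suc b) N)) = odd ((\<theta> ^^ Suc b) N)"
      using lt[of b] by (intro pair_perms_parity[OF \<theta>]) (simp add: N_def)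
    then show ?case using Suc by simp
  qed
  have "sign \<kappa> = 1"
  proof (rule sign_block_permutation)
    show "\<kappa> permutes {..<2 * n}" using \<kappa> by (simp add: N_def)
  next
    fix a assume a: "a < 2 * n" "even a"
    then show "even (\<kappa> a)" using par[of a] by (simp add: \<kappa>_def N_def)
    have "Suc a < N" using a by (auto simp: N_def elim!: evenE)
    then have "\<kappa> (Suc a) = \<theta> (\<kappa> a)" by (simp add: \<kappa>_def)
    moreover obtain i where "\<kappa> a = 2 * i" using \<open>even (\<kappa> a)\<close> by blast
    moreover have "\<kappa> a < N" using a lt[of a] by (simp add: \<kappa>_def N_def)
    ultimately show "\<kappa> (Suc a) = Suc (\<kappa> a)"
      using \<theta> by (simp add: pair_perms_def N_def)
  qed
  moreover have "\<kappa> (succ_cycle N a) = \<theta> (\<kappa> a)" if "a \<le> N" for a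
  proof (cases "a = N")
    case True
    have "\<kappa> 0 = \<theta> N"
    proof (cases "N = 0")
      case True
      then show ?thesis using cyc by (simp add: \<kappa>_def)
    qed (simp add: \<kappa>_def)
    then show ?thesis using True by (simp add: succ_cycle_def \<kappa>_def)
  next
    case False
    then have "a < N" using that by simp
    moreover have "\<theta> ((\<theta> ^^ Suc a) N) = \<kappa> (Suc a)"
      using cyc \<open>a < N\<close> by (cases "Suc a = N") (auto simp: \<kappa>_def)
    ultimately show ?thesis by (simp add: succ_cycle_def \<kappa>_def)
  qed
  ultimately show "alt_trace n (2 * n) B \<theta> = alt_trace n (2 * n) B (succ_cycle (2 * n))"
    using alt_trace_conj[OF \<kappa> succ_cycle_permutes, of \<theta> n B] by (simp add: N_def)
qed

text \<open>Each term of the vanishing sum over \<open>pair_perms\<close> is zero or equal to this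
  one, which occurs at least once. Its multiplicity \<open>card F\<close> can be cancelled over the
  integers, hence the restriction to integral matrices so far.\<close>

lemma alt_trace_succ_cycle: "alt_trace n (2 * n) B (succ_cycle (2 * n)) = 0"
proof -
  define F where "F = {\<theta> \<in> pair_perms n. \<forall>a\<le>2 * n. \<exists>k. (\<theta> ^^ k) a = 2 * n}"
  have fin: "finite F" using finite_pair_perms by (simp add: F_def)
  have "(succ_cycle (2*n) ^^ k) a = 2 * n" if "a + k = 2 * n" for k a
    using that
  proof (induction k arbitrary: a)
    case (Suc k)
    then have "succ_cycle (2*n) a = Suc a" "Suc a + k = 2 * n" by (auto simp: succ_cycle_def)
    then show ?case using Suc.IH[of "Suc a"] by (metis comp_apply funpow_Suc_right)
  qed simp
  then have "\<exists>k. (succ_cycle (2*n) ^^ k) a = 2 * n" if "a \<le> 2 * n" for a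
    using that le_add_diff_inverse by blast
  then have "succ_cycle (2 * n) \<in> F"
    using succ_cycle_in_pair_perms by (simp add: F_def)
  have "0 = (\<Sum>\<theta>\<in>pair_perms n. sign \<theta> * alt_trace n (2 * n) B \<theta>)"
    by (simp add: pair_perms_alt_trace_sum)
  also have "\<dots> = (\<Sum>\<theta>\<in>F. sign \<theta> * alt_trace n (2 * n) B \<theta>)"
  proof (rule sum.mono_neutral_right)
    show "\<forall>\<theta>\<in>pair_perms n - F. sign \<theta> * alt_trace n (2 * n) B \<theta> = 0"
      using alt_trace_not_full by (fastforce simp: F_def)
  qed (auto simp: F_def finite_pair_perms)
  also have "\<dots> = (\<Sum>\<theta>\<in>F. alt_trace n (2 * n) B (succ_cycle (2 * n)))"
  proof (rule sum.cong[OF refl])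
    fix \<theta> assume "\<theta> \<in> F"
    then have \<theta>: "\<theta> \<in> pair_perms n" "\<And>a. a \<le> 2 * n \<Longrightarrow> \<exists>k. (\<theta> ^^ k) a = 2 * n"
      by (auto simp: F_def)
    show "sign \<theta> * alt_trace n (2 * n) B \<theta> = alt_trace n (2 * n) B (succ_cycle (2 * n))"
      using pair_perms_full(1)[OF \<theta>] pair_perms_full(2)[OF \<theta>, of B] by simp
  qed
  also have "\<dots> = int (card F) * alt_trace n (2 * n) B (succ_cycle (2 * n))"
    by simp
  finally show ?thesis
    using fin \<open>succ_cycle (2 * n) \<in> F\<close> by auto
qed

section \<open>Matrix products as sums over walks\<close>

definition mat_mul :: "nat \<Rightarrow> (nat \<Rightarrow> nat \<Rightarrow> 'c) \<Rightarrow> (nat \<Rightarrow> nat \<Rightarrow> 'c) \<Rightarrow> nat \<Rightarrow> nat \<Rightarrow> 'c::comm_ring_1"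
  where "mat_mul n A B = (\<lambda>i j. \<Sum>k<n. A i k * B k j)"

text \<open>Matrices are functions on all pairs of naturals, of which only the entries below the
  current size carry meaning; hence the index bounds in the lemmas.\<close>

definition mat_one :: "nat \<Rightarrow> nat \<Rightarrow> 'c::comm_ring_1"
  where "mat_one = (\<lambda>i j. if i = j then 1 else 0)"

definition mat_prod :: "nat \<Rightarrow> (nat \<Rightarrow> nat \<Rightarrow> 'c::comm_ring_1) list \<Rightarrow> nat \<Rightarrow> nat \<Rightarrow> 'c"
  where "mat_prod n Ms = foldr (mat_mul n) Ms mat_one"

definition walks :: "nat \<Rightarrow> nat \<Rightarrow> nat \<Rightarrow> nat \<Rightarrow> (nat \<Rightarrow> nat) set"
  where "walks n L i j = {w \<in> {..L} \<rightarrow>\<^sub>E {..<n}. w 0 = i \<and> w L = j}"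

lemma finite_walks: "finite (walks n L i j)"
  by (rule finite_subset[of _ "{..L} \<rightarrow>\<^sub>E {..<n}"]) (auto simp: walks_def intro: finite_PiE)

lemma mat_prod_Nil [simp]: "mat_prod n [] = mat_one"
  and mat_prod_Cons [simp]: "mat_prod n (M # Ms) = mat_mul n M (mat_prod n Ms)"
  by (simp_all add: mat_prod_def)

lemma sum_walks_Suc:
  assumes "i < n"
  shows "(\<Sum>w\<in>walks n (Suc L) i j. f w)
    = (\<Sum>k<n. \<Sum>w\<in>walks n L k j. f (case_nat i w))"
proof -
  have "(\<Sum>k<n. \<Sum>w\<in>walks n L k j. f (case_nat i w))
      = (\<Sum>w\<in>(\<Union>k\<in>{..<n}. walks n L k j). f (case_nat i w))"
    by (rule sum.UNION_disjoint[symmetric]) (auto simp: finite_walks, auto simp: walks_def)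
  also have "\<dots> = (\<Sum>w\<in>walks n (Suc L) i j. f w)"
  proof (rule sum.reindex_bij_witness[of _ "\<lambda>w. w \<circ> Suc" "case_nat i"])
    fix w assume w: "w \<in> walks n (Suc L) i j"
    show "case_nat i (w \<circ> Suc) = w"
      using w by (auto simp: walks_def fun_eq_iff split: nat.splits)
    show "w \<circ> Suc \<in> (\<Union>k\<in>{..<n}. walks n L k j)"
      using w by (auto simp: walks_def PiE_iff extensional_def)
  next
    fix w assume w: "w \<in> (\<Union>k\<in>{..<n}. walks n L k j)"
    show "case_nat i w \<circ> Suc = w" by auto
    show "case_nat i w \<in> walks n (Suc L) i j"
      using w assms by (auto simp: walks_def PiE_iff extensional_def split: nat.splits)
  qed auto
  finally show ?thesis by simp
qed

lemma mat_prod_eq_sum_walks: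
  assumes "i < n" "j < n"
  shows "mat_prod n Ms i j = (\<Sum>w\<in>walks n (length Ms) i j. \<Prod>a<length Ms. (Ms ! a) (w a) (w (Suc a)))"
  using assms(1)
proof (induction Ms arbitrary: i)
  case Nil
  have "walks n 0 i j = (if i = j then {\<lambda>a. if a = 0 then i else undefined} else {})"
    using Nil by (auto simp: walks_def PiE_iff extensional_def)
  then show ?case by (simp add: mat_one_def)
next
  case (Cons M Ms)
  have "mat_prod n (M # Ms) i j = (\<Sum>k<n. M i k * mat_prod n Ms k j)"
    by (simp add: mat_mul_def)
  also have "\<dots> = (\<Sum>k<n. \<Sum>w\<in>walks n (length Ms) k j.
      M i (w 0) * (\<Prod>a<length Ms. (Ms ! a) (w a) (w (Suc a))))"
    by (rule sum.cong[OF refl]) (auto simp: Cons.IH sum_distrib_left walks_def intro!: sum.cong)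
  also have "\<dots> = (\<Sum>w\<in>walks n (length (M # Ms)) i j.
      \<Prod>a<length (M # Ms). ((M # Ms) ! a) (w a) (w (Suc a)))"
    by (simp add: sum_walks_Suc[OF Cons.prems] prod.lessThan_Suc_shift del: prod.lessThan_Suc)
  finally show ?case .
qed

text \<open>The entry \<open>(i, j)\<close> of the standard polynomial of degree
  \<open>2 * n\<close>, expanded over walks so that it is visibly multilinear in the matrix
  entries.\<close>

definition alt_walks :: "nat \<Rightarrow> (nat \<Rightarrow> nat \<Rightarrow> nat \<Rightarrow> 'c::comm_ring_1) \<Rightarrow> nat \<Rightarrow> nat \<Rightarrow> 'c"
  where "alt_walks n A i j = (\<Sum>\<tau> | \<tau> permutes {..<2 * n}. of_int (sign \<tau>) *
      (\<Sum>w\<in>walks n (2 * n) i j. \<Prod>a<2 * n. A (\<tau> a) (w a) (w (Suc a))))"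

text \<open>The extra factor of \<open>B\<close> in position \<open>2n\<close> closes the walk.\<close>

lemma alt_walks_int: "alt_walks n (A :: nat \<Rightarrow> nat \<Rightarrow> nat \<Rightarrow> int) r s = 0"
proof -
  define N where "N = 2 * n"
  \<comment> \<open>The marked matrix is the unit \<open>E\<^sub>s\<^sub>r\<close>, so the trace
    picks out the entry \<open>(r, s)\<close> of the standard polynomial.\<close>
  define B where "B t = (if t = N then \<lambda>i j. if i = s \<and> j = r then 1 else 0 else A t)" for t
  have "(\<Sum>w\<in>{..N} \<rightarrow>\<^sub>E {..<n}. cyc_weight N B (succ_cycle N) \<tau> w)
      = (\<Sum>w\<in>walks n N r s. \<Prod>a<N. A (\<tau> a) (w a) (w (Suc a)))"
    if \<tau>: "\<tau> permutes {..<N}" for \<tau>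
  proof -
    have \<tau>N: "\<tau> N = N" "\<And>a. a < N \<Longrightarrow> \<tau> a \<noteq> N"
      using permutes_not_in[OF \<tau>, of N] permutes_in_image[OF \<tau>] by auto
    have "cyc_weight N B (succ_cycle N) \<tau> w
      = (if w 0 = r \<and> w N = s then \<Prod>a<N. A (\<tau> a) (w a) (w (Suc a)) else 0)" for w
    proof -
      have "(\<Prod>a<N. B (\<tau> a) (w a) (w (succ_cycle N a))) = (\<Prod>a<N. A (\<tau> a) (w a) (w (Suc a)))"
        by (rule prod.cong) (auto simp: B_def \<tau>N succ_cycle_def)
      then show ?thesis
        unfolding cyc_weight_def lessThan_Suc_atMost[symmetric]
        by (simp add: B_def \<tau>N succ_cycle_def)
    qed
    then show ?thesis
      unfolding walks_def by (simp add: sum.inter_filter[symmetric] finite_PiE)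
  qed
  then have "alt_walks n A r s = alt_trace n N B (succ_cycle N)"
    unfolding alt_walks_def alt_trace_def N_def[symmetric] by simp
  then show ?thesis by (simp add: N_def alt_trace_succ_cycle)
qed

text \<open>By multilinearity the coefficients of the expression as a polynomial in the matrix entries are
  values of the integral one at matrix units.\<close>

lemma alt_walks_eq_0: "alt_walks n (A :: nat \<Rightarrow> nat \<Rightarrow> nat \<Rightarrow> 'c::comm_ring_1) r s = 0"
proof -
  define N where "N = 2 * n"
  define prs where "prs = {..<n} \<times> {..<n}"
  define U :: "(nat \<Rightarrow> nat \<times> nat) \<Rightarrow> nat \<Rightarrow> nat \<Rightarrow> nat \<Rightarrow> int"
    where "U e t i j = (if e t = (i, j) then 1 else 0)" for e t i j
  have expand: "(\<Prod>a<N. A (\<tau> a) (w a) (w (Suc a)))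
    = (\<Sum>e\<in>{..<N} \<rightarrow>\<^sub>E prs. (\<Prod>t<N. A t (fst (e t)) (snd (e t))) *
        of_int (\<Prod>a<N. U e (\<tau> a) (w a) (w (Suc a))))"
    if \<tau>: "\<tau> permutes {..<N}" and w: "w \<in> walks n N r s" for \<tau> w
  proof -
    let ?\<tau>' = "inv_into UNIV \<tau>"
    \<comment> \<open>\<open>f t\<close> is the step of the walk at which the matrix
      \<open>A t\<close> is used; among the choices \<open>e\<close> of one matrix unit for each
      \<open>t\<close>, only the one agreeing with \<open>f\<close> contributes.\<close>
    define f where "f t = (w (?\<tau>' t), w (Suc (?\<tau>' t)))" for t
    have \<tau>'\<tau>: "?\<tau>' (\<tau> a) = a" for a using permutes_inverses(2)[OF \<tau>] .
    have f_prs: "f t \<in> prs" if "t < N" for t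
      using w that permutes_in_image[OF permutes_inv[OF \<tau>], of t]
      by (auto simp: f_def prs_def walks_def PiE_iff)
    have "(\<Prod>a<N. A (\<tau> a) (w a) (w (Suc a))) = (\<Prod>t<N. A t (fst (f t)) (snd (f t)))"
      using prod.permute[OF \<tau>, of "\<lambda>t. A t (fst (f t)) (snd (f t))"] by (simp add: o_def f_def \<tau>'\<tau>)
    also have "\<dots> = (\<Prod>t<N. \<Sum>y\<in>prs. A t (fst y) (snd y) * (if y = f t then 1 else 0))"
    proof (rule prod.cong[OF refl])
      fix t assume "t \<in> {..<N}"
      then show "A t (fst (f t)) (snd (f t)) = (\<Sum>y\<in>prs. A t (fst y) (snd y) * (if y = f t then 1 else 0))"
        using f_prs[of t] by (simp add: prs_def if_distrib[of "(*) _"] sum.delta cong: if_cong)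
    qed
    also have "\<dots> = (\<Sum>e\<in>{..<N} \<rightarrow>\<^sub>E prs. \<Prod>t<N. A t (fst (e t)) (snd (e t)) * (if e t = f t then 1 else 0))"
      by (rule prod_sum_PiE) (auto simp: prs_def)
    also have "\<dots> = (\<Sum>e\<in>{..<N} \<rightarrow>\<^sub>E prs. (\<Prod>t<N. A t (fst (e t)) (snd (e t))) *
        of_int (\<Prod>a<N. U e (\<tau> a) (w a) (w (Suc a))))"
    proof (rule sum.cong[OF refl])
      fix e
      have "(\<Prod>t<N. if e t = f t then 1 else 0 :: 'c) = (\<Prod>a<N. if e (\<tau> a) = f (\<tau> a) then 1 else 0)"
        using prod.permute[OF \<tau>, of "\<lambda>t. if e t = f t then 1 else 0 :: 'c"] by (simp add: o_def)
      also have "\<dots> = of_int (\<Prod>a<N. U e (\<tau> a) (w a) (w (Suc a)))"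
        unfolding of_int_prod by (rule prod.cong) (auto simp: U_def f_def \<tau>'\<tau>)
      finally show "(\<Prod>t<N. A t (fst (e t)) (snd (e t)) * (if e t = f t then 1 else 0))
        = (\<Prod>t<N. A t (fst (e t)) (snd (e t))) * of_int (\<Prod>a<N. U e (\<tau> a) (w a) (w (Suc a)))"
        by (simp add: prod.distrib)
    qed
    finally show ?thesis .
  qed
  have "alt_walks n A r s = (\<Sum>\<tau> | \<tau> permutes {..<N}. \<Sum>w\<in>walks n N r s. \<Sum>e\<in>{..<N} \<rightarrow>\<^sub>E prs.
      of_int (sign \<tau>) * ((\<Prod>t<N. A t (fst (e t)) (snd (e t))) *
        of_int (\<Prod>a<N. U e (\<tau> a) (w a) (w (Suc a)))))"
    unfolding alt_walks_def N_def[symmetric] by (simp add: sum_distrib_left expand)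
  also have "\<dots> = (\<Sum>\<tau> | \<tau> permutes {..<N}. \<Sum>e\<in>{..<N} \<rightarrow>\<^sub>E prs. \<Sum>w\<in>walks n N r s.
      of_int (sign \<tau>) * ((\<Prod>t<N. A t (fst (e t)) (snd (e t))) *
        of_int (\<Prod>a<N. U e (\<tau> a) (w a) (w (Suc a)))))"
    by (rule sum.cong[OF refl], rule sum.swap)
  also have "\<dots> = (\<Sum>e\<in>{..<N} \<rightarrow>\<^sub>E prs. \<Sum>\<tau> | \<tau> permutes {..<N}. \<Sum>w\<in>walks n N r s.
      of_int (sign \<tau>) * ((\<Prod>t<N. A t (fst (e t)) (snd (e t))) *
        of_int (\<Prod>a<N. U e (\<tau> a) (w a) (w (Suc a)))))"
    by (rule sum.swap)
  also have "\<dots> = (\<Sum>e\<in>{..<N} \<rightarrow>\<^sub>E prs. (\<Prod>t<N. A t (fst (e t)) (snd (e t))) * of_int (alt_walks n (U e) r s))"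
    unfolding alt_walks_def N_def[symmetric] of_int_sum of_int_mult sum_distrib_left
    by (simp add: ac_simps)
  also have "\<dots> = 0" by (simp add: alt_walks_int)
  finally show ?thesis .
qed

theorem amitsur_levitzki:
  fixes A :: "nat \<Rightarrow> nat \<Rightarrow> nat \<Rightarrow> 'c::comm_ring_1"
  assumes "i < n" "j < n"
  shows "(\<Sum>\<tau> | \<tau> permutes {..<2 * n}. of_int (sign \<tau>) * mat_prod n (map (\<lambda>a. A (\<tau> a)) [0..<2 * n]) i j) = 0"
proof -
  have "mat_prod n (map (\<lambda>a. A (\<tau> a)) [0..<2 * n]) i j
      = (\<Sum>w\<in>walks n (2 * n) i j. \<Prod>a<2 * n. A (\<tau> a) (w a) (w (Suc a)))" for \<tau>
    unfolding mat_prod_eq_sum_walks[OF assms] by simp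
  then show ?thesis using alt_walks_eq_0[of n A i j] by (simp add: alt_walks_def)
qed

section \<open>Matrix representations of free algebras\<close>

lemma mat_prod_append:
  assumes "i < n"
  shows "mat_prod n (As @ Bs) i j = mat_mul n (mat_prod n As) (mat_prod n Bs) i j"
  using assms
proof (induction As arbitrary: i)
  case Nil
  then show ?case by (simp add: mat_mul_def mat_one_def if_distrib[of "\<lambda>x. x * _"] cong: if_cong)
next
  case (Cons A As)
  have "mat_prod n ((A # As) @ Bs) i j = (\<Sum>k<n. \<Sum>m<n. A i k * mat_prod n As k m * mat_prod n Bs m j)"
    using Cons.IH by (simp add: mat_mul_def sum_distrib_left mult.assoc)
  also have "\<dots> = (\<Sum>m<n. \<Sum>k<n. A i k * mat_prod n As k m * mat_prod n Bs m j)"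
    by (rule sum.swap)
  also have "\<dots> = mat_mul n (mat_prod n (A # As)) (mat_prod n Bs) i j"
    by (simp add: mat_mul_def sum_distrib_right)
  finally show ?case .
qed

lemma poly_mapping_eq_sum_single: "f = (\<Sum>w\<in>Poly_Mapping.keys f. Poly_Mapping.single w (Poly_Mapping.lookup f w))"
  by (rule poly_mapping_eqI)
    (auto simp: lookup_sum lookup_single when_def sum.delta in_keys_iff)

lemma free_alg_induct [case_names add scalar gen]:
  fixes f :: "('x, 'k::ring_1) free_alg"
  assumes add: "\<And>f g. P f \<Longrightarrow> P g \<Longrightarrow> P (f + g)"
    and scalar: "\<And>c. P (scalar c)"
    and gen: "\<And>v f. P f \<Longrightarrow> P (gen v * f)"
  shows "P f"
proof -
  have single: "P (Poly_Mapping.single (Word vs) c)" for vs c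
  proof (induction vs)
    case Nil
    then show ?case using scalar[of c] by (simp add: scalar_def zero_free_word_def)
  next
    case (Cons v vs)
    have "Poly_Mapping.single (Word (v # vs)) c = gen v * Poly_Mapping.single (Word vs) c"
      by (simp add: gen_def mult_single plus_free_word_def)
    then show ?case using gen[OF Cons] by simp
  qed
  have "P (\<Sum>w\<in>B. Poly_Mapping.single w (Poly_Mapping.lookup f w))" if "finite B" for B
    using that
  proof (induction B)
    case empty
    then show ?case using scalar[of 0] by (simp add: scalar_def)
  next
    case (insert w B)
    then show ?case using add single by (cases w) simp
  qed
  from this[OF finite_keys[of f]] show ?thesis
    by (simp add: poly_mapping_eq_sum_single[symmetric])
qed

lemma scalar_add: "scalar (c + d) = scalar c + scalar d"
  by (simp add: scalar_def single_add)

lemma scalar_mult: "scalar (c * d) = scalar c * scalar d"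
  by (simp add: scalar_def mult_single)

lemma scalar_0 [simp]: "scalar 0 = 0"
  by (simp add: scalar_def)

lemma scalar_1 [simp]: "scalar 1 = 1"
  by (simp add: scalar_def)

lemma scalar_commute: "scalar (c :: 'k::comm_ring_1) * f = f * scalar c"
proof (induction f rule: free_alg_induct)
  case (add f g)
  then show ?case by (simp add: algebra_simps)
next
  case (scalar d)
  then show ?case by (simp add: scalar_mult[symmetric] mult.commute)
next
  case (gen v f)
  have "scalar c * gen v = gen v * (scalar c :: ('a, 'k) free_alg)"
    by (simp add: scalar_def gen_def mult_single)
  then show ?case using gen by (metis mult.assoc)
qed

text \<open>The homomorphism \<open>h\<close> extends scalars, so that one development serves both
  the polynomial ring of the generic representation and the field itself.\<close>

locale matrix_rep =
  fixes l :: nat and h :: "'k::comm_ring_1 \<Rightarrow> 'c::comm_ring_1" and G :: "'x \<Rightarrow> nat \<Rightarrow> nat \<Rightarrow> 'c"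
  assumes h_add [simp]: "h (a + b) = h a + h b"
    and h_mult [simp]: "h (a * b) = h a * h b"
    and h_1 [simp]: "h 1 = 1"
begin

lemma h_0 [simp]: "h 0 = 0"
  using h_add[of 0 0] by simp

lemma h_uminus [simp]: "h (- a) = - h a"
  using h_add[of a "- a"] by (simp add: eq_neg_iff_add_eq_0 add.commute)

lemma h_diff [simp]: "h (a - b) = h a - h b"
  using h_add[of a "- b"] by simp

lemma h_power [simp]: "h (a ^ n) = h a ^ n"
  by (induction n) auto

definition rep :: "('x, 'k) free_alg \<Rightarrow> nat \<Rightarrow> nat \<Rightarrow> 'c"
  where "rep f i j = (\<Sum>w\<in>Poly_Mapping.keys f.
    h (Poly_Mapping.lookup f w) * mat_prod l (map G (letters w)) i j)"

lemma rep_add [simp]: "rep (f + g) i j = rep f i j + rep g i j"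
  unfolding rep_def by (rule setsum_keys_plus_distrib) (auto simp: algebra_simps)

lemma rep_0 [simp]: "rep 0 i j = 0"
  by (simp add: rep_def)

lemma rep_uminus [simp]: "rep (- f) i j = - rep f i j"
  using rep_add[of f "- f" i j] by (simp add: eq_neg_iff_add_eq_0 add.commute)

lemma rep_diff [simp]: "rep (f - g) i j = rep f i j - rep g i j"
  using rep_add[of f "- g" i j] by simp

lemma rep_sum [simp]: "rep (sum f B) i j = (\<Sum>b\<in>B. rep (f b) i j)"
  by (induction B rule: infinite_finite_induct) auto

lemma rep_single: "rep (Poly_Mapping.single w c) i j = h c * mat_prod l (map G (letters w)) i j"
  by (cases "c = 0") (auto simp: rep_def)

lemma rep_scalar: "rep (scalar c) i j = h c * mat_one i j"
  by (simp add: scalar_def rep_single zero_free_word_def)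

lemma rep_1: "rep 1 i j = mat_one i j"
  using rep_scalar[of 1 i j] by simp

lemma rep_gen: "j < l \<Longrightarrow> rep (gen v) i j = G v i j"
  by (simp add: gen_def rep_single mat_mul_def mat_one_def if_distrib[of "(*) _"] cong: if_cong)

text \<open>Both sides are biadditive, and for monomials the claim is concatenation of
  words.\<close>

lemma rep_mult:
  assumes "i < l"
  shows "rep (f * g) i j = mat_mul l (rep f) (rep g) i j"
proof -
  have "rep (Poly_Mapping.single v c * Poly_Mapping.single w d) i j
      = (\<Sum>k<l. rep (Poly_Mapping.single v c) i k * rep (Poly_Mapping.single w d) k j)" for v w c d
    using assms
    by (simp add: mult_single rep_single plus_free_word_def mat_prod_append mat_mul_def sum_distrib_left
        ac_simps)
  then have "rep (Poly_Mapping.single v c * g) i j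
      = (\<Sum>k<l. rep (Poly_Mapping.single v c) i k * rep g k j)" for v c
    by (subst (1 2) poly_mapping_eq_sum_single[of g])
      (simp add: sum_distrib_left sum.swap[of _ "{..<l}"])
  then show ?thesis
    by (subst (1 2) poly_mapping_eq_sum_single[of f])
      (simp add: sum_distrib_right sum.swap[of _ "{..<l}"] mat_mul_def)
qed

lemma rep_scalar_mult:
  assumes "i < l"
  shows "rep (scalar c * f) i j = h c * rep f i j"
proof -
  have "rep (scalar c * f) i j = (\<Sum>k<l. if i = k then h c * rep f k j else 0)"
    unfolding rep_mult[OF assms] mat_mul_def by (rule sum.cong) (auto simp: rep_scalar mat_one_def)
  then show ?thesis using assms by simp
qed

lemma rep_prod_list:
  "i < l \<Longrightarrow> j < l \<Longrightarrow> rep (prod_list fs) i j = mat_prod l (map rep fs) i j"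
  by (induction fs arbitrary: i) (simp_all add: rep_1 rep_mult mat_mul_def)

definition rep_kernel :: "('x, 'k) free_alg set"
  where "rep_kernel = {f. \<forall>i<l. \<forall>j<l. rep f i j = 0}"

lemma ideal_rep_kernel: "ideal rep_kernel ring_of_type_algebra"
proof (rule idealI)
  show "ring (ring_of_type_algebra :: ('x, 'k) free_alg ring)" by (rule ring_ring_of_type_algebra)
  interpret ring "ring_of_type_algebra :: ('x, 'k) free_alg ring" by (rule ring_ring_of_type_algebra)
  show "subgroup rep_kernel (add_monoid (ring_of_type_algebra :: ('x, 'k) free_alg ring))"
  proof (rule add.subgroupI)
    fix f assume f: "f \<in> rep_kernel"
    have "\<ominus>\<^bsub>ring_of_type_algebra\<^esub> f = - f"
      by (rule minus_equality) (simp_all add: ring_of_type_algebra_def)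
    then show "\<ominus>\<^bsub>ring_of_type_algebra\<^esub> f \<in> rep_kernel"
      using f by (simp add: rep_kernel_def)
  next
    have "0 \<in> rep_kernel" by (simp add: rep_kernel_def)
    then show "rep_kernel \<noteq> {}" by blast
  qed (auto simp: ring_of_type_algebra_def rep_kernel_def)
qed (auto simp: ring_of_type_algebra_def rep_kernel_def rep_mult mat_mul_def)

end

section \<open>A representation of the algebra\<close>

text \<open>The quotient is symmetric in \<open>q\<close> and \<open>r\<close>. The first recursion
  yields the relation \<open>yx - qxy = z\<close>, the second the diagonal action of
  \<open>u\<close>.\<close>

lemma quantum_bracket_Suc:
  fixes q r :: "'k::field"
  assumes "q - r \<noteq> 0"
  shows "(q ^ Suc i - r ^ Suc i) / (q - r) = q * ((q ^ i - r ^ i) / (q - r)) + r ^ i"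
    and "(q ^ Suc i - r ^ Suc i) / (q - r) = r * ((q ^ i - r ^ i) / (q - r)) + q ^ i"
  using assms by (simp_all add: divide_simps) (simp_all add: algebra_simps)

lemma add_mod_right_cancel_less:
  fixes a b k l :: nat
  assumes "a < l" "b < l" "(a + k) mod l = (b + k) mod l"
  shows "a = b"
proof -
  have *: "x \<le> y" if "x < l" "(x + k) mod l = (y + k) mod l" for x y :: nat
  proof (rule ccontr)
    assume "\<not> x \<le> y"
    then have "l dvd x - y" using that mod_eq_dvd_iff_nat[of "y + k" "x + k" l] by simp
    then show False using \<open>\<not> x \<le> y\<close> that(1) by (auto dest!: dvd_imp_le)
  qed
  show ?thesis using *[of a b] *[of b a] assms by simp
qed

text \<open>Here \<open>l\<close> is any common period of \<open>p\<close> and \<open>q\<close>;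
  primitivity of the roots enters with \<open>H_roots\<close>, for the lower bound.\<close>

locale H_params =
  fixes p q :: "'k::field" and l :: nat
  assumes p0: "p \<noteq> 0" and q0: "q \<noteq> 0" and pq: "p * q \<noteq> 1"
    and l0: "l > 0" and pl: "p ^ l = 1" and ql: "q ^ l = 1"
begin

abbreviation ip :: 'k where "ip \<equiv> inverse p"
abbreviation iq :: 'k where "iq \<equiv> inverse q"

definition qnum :: "nat \<Rightarrow> 'k"
  where "qnum i = (q ^ i - ip ^ i) / (q - ip)"

lemma q_ip: "q - ip \<noteq> 0"
  using pq p0 by (metis eq_iff_diff_eq_0 right_inverse)

lemma qnum_Suc: "qnum (Suc i) = q * qnum i + ip ^ i"
  unfolding qnum_def by (rule quantum_bracket_Suc(1)[OF q_ip])

lemma qnum_Suc': "qnum (Suc i) = ip * qnum i + q ^ i"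
  unfolding qnum_def by (rule quantum_bracket_Suc(2)[OF q_ip])

lemma ipl: "ip ^ l = 1"
  by (simp add: power_inverse pl)

lemma power_mod_l: "p ^ (i mod l) = p ^ i" "q ^ (i mod l) = q ^ i" "ip ^ (i mod l) = ip ^ i"
proof -
  have *: "c ^ (i mod l) = c ^ i" if "c ^ l = 1" for c :: 'k
    by (metis that mod_mult_div_eq mult.right_neutral power_add power_mult power_one)
  show "p ^ (i mod l) = p ^ i" "q ^ (i mod l) = q ^ i" "ip ^ (i mod l) = ip ^ i"
    by (auto intro!: * pl ql ipl)
qed

lemma qnum_mod_l: "qnum (i mod l) = qnum i"
  by (simp add: qnum_def power_mod_l)

definition pred_mod :: "nat \<Rightarrow> nat"
  where "pred_mod i = (if i = 0 then l - 1 else i - 1)"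

lemma eq_Suc_mod_iff: "i < l \<Longrightarrow> k < l \<Longrightarrow> i = Suc k mod l \<longleftrightarrow> k = pred_mod i"
  by (auto simp: pred_mod_def mod_Suc)

lemma pred_mod_less: "i < l \<Longrightarrow> pred_mod i < l"
  by (auto simp: pred_mod_def)

lemma Suc_pred_mod: "i < l \<Longrightarrow> Suc (pred_mod i) mod l = i"
  using eq_Suc_mod_iff pred_mod_less by metis

lemma pred_mod_Suc: "i < l \<Longrightarrow> pred_mod (Suc i mod l) = i"
  using eq_Suc_mod_iff[of "Suc i mod l" i] l0 by simp

end

locale H_rep = H_params p q l
  for p q :: "'k::field" and l :: nat +
  fixes h :: "'k \<Rightarrow> 'c::comm_ring_1" and S Z D :: 'c
  assumes h: "\<And>a b. h (a + b) = h a + h b" "\<And>a b. h (a * b) = h a * h b" "h 1 = 1"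
begin

definition y_weight :: "nat \<Rightarrow> 'c"
  where "y_weight b = h (q ^ b) * D + h (qnum b) * Z"

text \<open>Column \<open>b\<close> holds the image of \<open>v\<^sub>b\<close>.\<close>

definition gen_mat :: "xyz \<Rightarrow> nat \<Rightarrow> nat \<Rightarrow> 'c"
  where "gen_mat v = (case v of
      Gx \<Rightarrow> (\<lambda>a b. if a = Suc b mod l then S else 0)
    | Gy \<Rightarrow> (\<lambda>a b. if b = Suc a mod l then y_weight b else 0)
    | Gz \<Rightarrow> (\<lambda>a b. if a = b then h (ip ^ b) * (S * Z) else 0))"

sublocale matrix_rep l h gen_mat
  by unfold_locales (auto simp: h)

lemma y_weight_mod: "y_weight (i mod l) = y_weight i"
  by (simp add: y_weight_def power_mod_l qnum_mod_l del: h_power)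

text \<open>This is the relation \<open>yx - qxy = z\<close> evaluated on
  \<open>v\<^sub>i\<close>.\<close>

lemma y_weight_Suc: "S * y_weight (Suc i) = h q * (S * y_weight i) + h (ip ^ i) * (S * Z)"
  by (simp add: y_weight_def qnum_Suc algebra_simps)

lemma rep_x_mult: "i < l \<Longrightarrow> j < l \<Longrightarrow> rep (gen Gx * f) i j = S * rep f (pred_mod i) j"
proof -
  assume ij: "i < l" "j < l"
  have "rep (gen Gx * f) i j = (\<Sum>k<l. if k = pred_mod i then S * rep f k j else 0)"
    unfolding rep_mult[OF ij(1)] mat_mul_def
    by (rule sum.cong) (use ij in \<open>auto simp: rep_gen gen_mat_def eq_Suc_mod_iff\<close>)
  then show ?thesis using pred_mod_less[OF ij(1)] by simp
qed

lemma rep_y_mult: "i < l \<Longrightarrow> j < l \<Longrightarrow> rep (gen Gy * f) i j = y_weight (Suc i) * rep f (Suc i mod l) j"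
proof -
  assume ij: "i < l" "j < l"
  have "rep (gen Gy * f) i j = (\<Sum>k<l. if k = Suc i mod l then y_weight k * rep f k j else 0)"
    unfolding rep_mult[OF ij(1)] mat_mul_def
    by (rule sum.cong) (use ij in \<open>auto simp: rep_gen gen_mat_def\<close>)
  then show ?thesis using l0 by (simp add: y_weight_mod)
qed

lemma rep_z_mult: "i < l \<Longrightarrow> j < l \<Longrightarrow> rep (gen Gz * f) i j = h (ip ^ i) * (S * Z) * rep f i j"
proof -
  assume ij: "i < l" "j < l"
  have "rep (gen Gz * f) i j = (\<Sum>k<l. if k = i then h (ip ^ i) * (S * Z) * rep f i j else 0)"
    unfolding rep_mult[OF ij(1)] mat_mul_def
    by (rule sum.cong) (use ij in \<open>auto simp: rep_gen gen_mat_def\<close>)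
  then show ?thesis using ij by simp
qed

lemma relations_in_kernel: "H_relations p q \<subseteq> rep_kernel"
proof -
  have g: "rep (gen v) i j = gen_mat v i j" if "i < l" "j < l" for v i j
    using that by (simp add: rep_gen)
  have zx: "rep (gen Gz * gen Gx - scalar ip * (gen Gx * gen Gz)) i j = 0" if ij: "i < l" "j < l" for i j
  proof -
    \<comment> \<open>At the wrap-around \<open>i = 0\<close> this is
      \<open>ip ^ l = 1\<close>.\<close>
    have "ip ^ i = ip * ip ^ pred_mod i"
      using Suc_pred_mod[OF ij(1)] power_mod_l(3)[of "Suc (pred_mod i)"] by simp
    then have "h (ip ^ i) = h ip * h (ip ^ pred_mod i)"
      by (metis h_mult)
    then show ?thesis using ij pred_mod_less[OF ij(1)]
      by (auto simp: rep_scalar_mult rep_x_mult rep_z_mult g gen_mat_def eq_Suc_mod_iff simp del: h_power)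
  qed
  have zy: "rep (gen Gz * gen Gy - scalar p * (gen Gy * gen Gz)) i j = 0" if ij: "i < l" "j < l" for i j
  proof -
    have "ip ^ i = p * ip ^ (Suc i mod l)"
      using p0 by (simp add: power_mod_l del: power_Suc) simp
    then have "h (ip ^ i) = h p * h (ip ^ (Suc i mod l))"
      by (metis h_mult)
    then show ?thesis using ij l0
      by (auto simp: rep_scalar_mult rep_y_mult rep_z_mult g gen_mat_def y_weight_mod simp del: h_power)
  qed
  have yx: "rep (gen Gy * gen Gx - scalar q * (gen Gx * gen Gy) - gen Gz) i j = 0" if ij: "i < l" "j < l" for i j
  proof -
    have "rep (gen Gy * gen Gx) i j = (if i = j then S * y_weight (Suc i) else 0)"
      using ij l0 eq_Suc_mod_iff[of "Suc i mod l" j] pred_mod_Suc[of i]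
      by (auto simp: rep_y_mult g gen_mat_def)
    moreover have "rep (gen Gx * gen Gy) i j = (if i = j then S * y_weight i else 0)"
      using ij pred_mod_less[of i] Suc_pred_mod[of i] by (auto simp: rep_x_mult g gen_mat_def)
    ultimately show ?thesis using ij by (simp add: rep_scalar_mult g gen_mat_def y_weight_Suc)
  qed
  show ?thesis
    by (auto simp: H_relations_def rep_kernel_def zx zy yx simp del: rep_diff)
qed

text \<open>Left multiplication by \<open>x\<close> rotates the rows and scales them by
  \<open>S\<close>, so the sum of the first column only acquires a power of \<open>S\<close>.
  Faithfulness is read off these column sums.\<close>

lemma rep_x_power_mult_sum: "(\<Sum>a<l. rep (gen Gx ^ i * f) a 0) = S ^ i * (\<Sum>a<l. rep f a 0)"
proof (induction i)
  case (Suc i)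
  have "(\<Sum>a<l. rep (gen Gx ^ Suc i * f) a 0) = (\<Sum>a<l. S * rep (gen Gx ^ i * f) (pred_mod a) 0)"
    using l0 by (intro sum.cong) (auto simp: rep_x_mult mult.assoc)
  also have "\<dots> = (\<Sum>a<l. S * rep (gen Gx ^ i * f) a 0)"
    by (rule sum.reindex_bij_witness[of _ "\<lambda>a. Suc a mod l" pred_mod])
      (auto simp: pred_mod_less pred_mod_Suc Suc_pred_mod l0)
  finally show ?case using Suc by (simp add: sum_distrib_left[symmetric] mult.assoc)
qed simp

lemma rep_z_power_mult: "i < l \<Longrightarrow> j < l \<Longrightarrow> rep (gen Gz ^ k * f) i j = (h (ip ^ i) * (S * Z)) ^ k * rep f i j"
  by (induction k) (simp_all add: rep_z_mult mult.assoc)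

text \<open>The weight at the index \<open>-s\<close> modulo \<open>l\<close>, written with natural
  exponents; \<open>y ^ k\<close> applied to \<open>v\<^sub>0\<close> meets those for
  \<open>s < k\<close>.\<close>

definition y_weight_neg :: "nat \<Rightarrow> 'c"
  where "y_weight_neg s = h (iq ^ s) * D + h ((iq ^ s - p ^ s) / (q - ip)) * Z"

lemma y_weight_eq_neg: "(b + s) mod l = 0 \<Longrightarrow> y_weight b = y_weight_neg s"
proof -
  assume "(b + s) mod l = 0"
  then have "q ^ (b + s) = 1" "p ^ (b + s) = 1"
    using power_mod_l(1,2)[of "b + s"] by simp_all
  then have "q ^ b = iq ^ s" "ip ^ b = p ^ s"
    using p0 q0 by (simp_all add: power_add field_simps)
  then show ?thesis by (simp add: y_weight_def y_weight_neg_def qnum_def del: h_power)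
qed

lemma rep_y_power:
  "a < l \<Longrightarrow> rep (gen Gy ^ k) a 0 = (if (a + k) mod l = 0 then \<Prod>s<k. y_weight_neg s else 0)"
proof (induction k arbitrary: a)
  case 0
  then show ?case by (simp add: rep_1 mat_one_def)
next
  case (Suc k)
  have "rep (gen Gy ^ Suc k) a 0 = y_weight (Suc a) * rep (gen Gy ^ k) (Suc a mod l) 0"
    using rep_y_mult[of a 0 "gen Gy ^ k"] Suc.prems l0 by simp
  also have "rep (gen Gy ^ k) (Suc a mod l) 0 = (if (Suc a mod l + k) mod l = 0 then \<Prod>s<k. y_weight_neg s else 0)"
    using l0 by (intro Suc.IH) simp
  also have "(Suc a mod l + k) mod l = (Suc a + k) mod l" by (simp add: mod_simps)
  finally show ?case using y_weight_eq_neg[of "Suc a" k] by (auto simp: mult.commute)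
qed

lemma rep_monomial_sum:
  "(\<Sum>a<l. rep (gen Gx ^ i * (gen Gz ^ j * gen Gy ^ k)) a 0)
    = S ^ i * (h (p ^ (k * j)) * (S * Z) ^ j * (\<Prod>s<k. y_weight_neg s))"
proof -
  \<comment> \<open>\<open>a0\<close> is \<open>-k\<close> modulo \<open>l\<close>, the only row in
    which \<open>y ^ k\<close> applied to \<open>v\<^sub>0\<close> can be nonzero.\<close>
  define a0 where "a0 = (l - k mod l) mod l"
  have a0: "a0 < l" "(a0 + k) mod l = 0"
  proof -
    have "(a0 + k) mod l = (l - k mod l + k mod l) mod l"
      unfolding a0_def by (metis mod_add_eq mod_add_right_eq)
    also have "l - k mod l + k mod l = l" using l0 by (simp add: less_imp_le)
    finally show "(a0 + k) mod l = 0" by simp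
  qed (use l0 in \<open>simp add: a0_def\<close>)
  have iff: "(a + k) mod l = 0 \<longleftrightarrow> a = a0" if "a < l" for a
  proof
    assume "(a + k) mod l = 0"
    then show "a = a0" using add_mod_right_cancel_less[of a l a0 k] that a0 by simp
  qed (use a0 in simp)
  have "q ^ (a0 + k) = 1" "p ^ (a0 + k) = 1"
    using power_mod_l(1,2)[of "a0 + k"] a0 by simp_all
  then have ipa: "ip ^ a0 = p ^ k"
    using p0 by (simp_all add: power_add field_simps)
  have "(\<Sum>a<l. rep (gen Gz ^ j * gen Gy ^ k) a 0)
      = (\<Sum>a<l. if a = a0 then (h (ip ^ a) * (S * Z)) ^ j * (\<Prod>s<k. y_weight_neg s) else 0)"
    using l0 by (intro sum.cong) (auto simp: rep_z_power_mult rep_y_power iff)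
  also have "\<dots> = (h (p ^ k) * (S * Z)) ^ j * (\<Prod>s<k. y_weight_neg s)"
    using a0 ipa by simp
  also have "(h (p ^ k) * (S * Z)) ^ j = h (p ^ (k * j)) * (S * Z) ^ j"
    by (simp add: power_mult_distrib power_mult)
  finally show ?thesis unfolding rep_x_power_mult_sum by simp
qed

end

section \<open>Faithfulness\<close>

definition H_ideal :: "'k::field \<Rightarrow> 'k \<Rightarrow> (xyz, 'k) free_alg set"
  where "H_ideal p q = Idl\<^bsub>ring_of_type_algebra\<^esub> (H_relations p q)"

lemma ideal_H_ideal: "ideal (H_ideal p q) ring_of_type_algebra"
  unfolding H_ideal_def
  by (rule ring.genideal_ideal[OF ring_ring_of_type_algebra]) (simp add: ring_of_type_algebra_def)

lemma H_relations_subset_H_ideal: "H_relations p q \<subseteq> H_ideal p q"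
  unfolding H_ideal_def
  by (rule ring.genideal_self[OF ring_ring_of_type_algebra]) (simp add: ring_of_type_algebra_def)

lemma H_ideal_mult:
  assumes "f \<in> H_ideal p q"
  shows "g * f \<in> H_ideal p q" and "f * g \<in> H_ideal p q"
  using ideal.I_l_closed[OF ideal_H_ideal assms, of g] ideal.I_r_closed[OF ideal_H_ideal assms, of g]
  by (simp_all add: ring_of_type_algebra_def)

lemma H_ideal_add: "f \<in> H_ideal p q \<Longrightarrow> g \<in> H_ideal p q \<Longrightarrow> f + g \<in> H_ideal p q"
  using additive_subgroup.a_closed[OF ideal.axioms(1)[OF ideal_H_ideal], of f p q g]
  by (simp add: ring_of_type_algebra_def)

lemma H_ideal_0 [simp]: "0 \<in> H_ideal p q"
  using additive_subgroup.zero_closed[OF ideal.axioms(1)[OF ideal_H_ideal], of p q]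
  by (simp add: ring_of_type_algebra_def)

lemma H_ideal_diff: "f \<in> H_ideal p q \<Longrightarrow> g \<in> H_ideal p q \<Longrightarrow> f - g \<in> H_ideal p q"
  using H_ideal_add[of f p q "- 1 * g"] H_ideal_mult(1)[of g p q "- 1"] by simp

context H_rep
begin

lemma H_ideal_subset_kernel: "H_ideal p q \<subseteq> rep_kernel"
  unfolding H_ideal_def
  by (rule ring.genideal_minimal[OF ring_ring_of_type_algebra ideal_rep_kernel relations_in_kernel])

end

context H_params
begin

section \<open>Ordered monomials span the algebra\<close>

definition pbw :: "nat \<times> nat \<times> nat \<Rightarrow> (xyz, 'k) free_alg"
  where "pbw = (\<lambda>(i, j, k). gen Gx ^ i * (gen Gz ^ j * gen Gy ^ k))"

text \<open>The rule \<open>congr\<close> makes this the span modulo the ideal. Independence of the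
  monomials comes later, from leading coefficients.\<close>

inductive_set pbw_span :: "(xyz, 'k) free_alg set"
  where pbw: "pbw t \<in> pbw_span"
  | add: "f \<in> pbw_span \<Longrightarrow> g \<in> pbw_span \<Longrightarrow> f + g \<in> pbw_span"
  | scalar: "f \<in> pbw_span \<Longrightarrow> scalar c * f \<in> pbw_span"
  | congr: "f \<in> pbw_span \<Longrightarrow> f - g \<in> H_ideal p q \<Longrightarrow> g \<in> pbw_span"

lemma pbw_span_gen_mult:
  assumes "\<And>t. gen v * pbw t \<in> pbw_span" and "f \<in> pbw_span"
  shows "gen v * f \<in> pbw_span"
  using assms(2)
proof induction
  case (add f g)
  then show ?case by (simp add: distrib_left pbw_span.add)
next
  case (scalar f c)
  have "gen v * (scalar c * f) = scalar c * (gen v * f)"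
    by (metis mult.assoc scalar_commute)
  then show ?case using scalar by (simp add: pbw_span.scalar)
next
  case (congr f g)
  have "gen v * f - gen v * g \<in> H_ideal p q"
    using H_ideal_mult(1)[OF congr(2), of "gen v"] by (simp add: algebra_simps)
  then show ?case using congr pbw_span.congr by blast
qed (rule assms(1))

lemma pbw_span_relation:
  "g * f \<in> pbw_span \<Longrightarrow> e - g \<in> H_relations p q \<Longrightarrow> e * f \<in> pbw_span"
proof -
  assume f: "g * f \<in> pbw_span" and e: "e - g \<in> H_relations p q"
  have "e - g \<in> H_ideal p q" using e H_relations_subset_H_ideal by blast
  from H_ideal_diff[OF H_ideal_0 H_ideal_mult(2)[OF this, of f]] have "g * f - e * f \<in> H_ideal p q" by (simp add: algebra_simps)
  with f show ?thesis by (rule pbw_span.congr)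
qed

lemma pbw_span_x: "f \<in> pbw_span \<Longrightarrow> gen Gx * f \<in> pbw_span"
proof (rule pbw_span_gen_mult)
  fix t :: "nat \<times> nat \<times> nat"
  obtain i j k where t: "t = (i, j, k)" by (cases t)
  have "gen Gx * pbw t = pbw (Suc i, j, k)" by (simp add: t pbw_def mult.assoc)
  then show "gen Gx * pbw t \<in> pbw_span" by (simp add: pbw_span.pbw)
qed

lemma pbw_span_z: "f \<in> pbw_span \<Longrightarrow> gen Gz * f \<in> pbw_span"
proof (rule pbw_span_gen_mult)
  fix t :: "nat \<times> nat \<times> nat"
  obtain i j k where t: "t = (i, j, k)" by (cases t)
  have "gen Gz * pbw (i, j, k) \<in> pbw_span"
  proof (induction i)
    case 0
    have "gen Gz * pbw (0, j, k) = pbw (0, Suc j, k)" by (simp add: pbw_def mult.assoc)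
    then show ?case by (simp add: pbw_span.pbw)
  next
    case (Suc i)
    have "gen Gx * (gen Gz * pbw (i, j, k)) \<in> pbw_span" by (rule pbw_span_x[OF Suc])
    then have "scalar ip * (gen Gx * gen Gz) * pbw (i, j, k) \<in> pbw_span"
      by (metis pbw_span.scalar mult.assoc)
    then have "gen Gz * gen Gx * pbw (i, j, k) \<in> pbw_span"
      by (rule pbw_span_relation) (simp add: H_relations_def)
    then show ?case by (simp add: pbw_def mult.assoc)
  qed
  then show "gen Gz * pbw t \<in> pbw_span" by (simp add: t)
qed

text \<open>First \<open>y\<close> passes \<open>x\<close> by \<open>yx = qxy + z\<close>, then
  \<open>z\<close> by \<open>zy = pyz\<close>. The resulting terms begin with \<open>x\<close> or
  \<open>z\<close>, for which closure is already known.\<close>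

lemma pbw_span_y: "f \<in> pbw_span \<Longrightarrow> gen Gy * f \<in> pbw_span"
proof (rule pbw_span_gen_mult)
  fix t :: "nat \<times> nat \<times> nat"
  obtain i j k where t: "t = (i, j, k)" by (cases t)
  have "gen Gy * pbw (i, j, k) \<in> pbw_span"
  proof (induction i)
    case 0
    show ?case
    proof (induction j)
      case 0
      have "gen Gy * pbw (0, 0, k) = pbw (0, 0, Suc k)" by (simp add: pbw_def)
      then show ?case by (simp add: pbw_span.pbw)
    next
      case (Suc j)
      let ?f = "pbw (0, j, k)"
      have "gen Gz * gen Gy * ?f \<in> pbw_span" using pbw_span_z[OF Suc] by (simp add: mult.assoc)
      then have "scalar ip * (gen Gz * gen Gy * ?f) \<in> pbw_span" by (rule pbw_span.scalar)
      moreover have "scalar ip * (gen Gz * gen Gy * ?f) - gen Gy * gen Gz * ?f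
          = scalar ip * ((gen Gz * gen Gy - scalar p * (gen Gy * gen Gz)) * ?f)"
        using p0 by (simp add: algebra_simps) (simp add: mult.assoc[symmetric] scalar_mult[symmetric])
      moreover have "\<dots> \<in> H_ideal p q"
        using H_relations_subset_H_ideal[of p q] by (intro H_ideal_mult) (auto simp: H_relations_def)
      ultimately have "gen Gy * gen Gz * ?f \<in> pbw_span" using pbw_span.congr by simp
      then show ?case by (simp add: pbw_def mult.assoc)
    qed
  next
    case (Suc i)
    let ?f = "pbw (i, j, k)"
    have "scalar q * (gen Gx * (gen Gy * ?f)) + gen Gz * ?f \<in> pbw_span"
      by (intro pbw_span.add pbw_span.scalar pbw_span_x Suc pbw_span_z pbw_span.pbw)
    then have "(scalar q * (gen Gx * gen Gy) + gen Gz) * ?f \<in> pbw_span"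
      by (simp add: algebra_simps)
    then have "gen Gy * gen Gx * ?f \<in> pbw_span"
      by (rule pbw_span_relation) (simp add: H_relations_def algebra_simps)
    then show ?case by (simp add: pbw_def mult.assoc)
  qed
  then show "gen Gy * pbw t \<in> pbw_span" by (simp add: t)
qed

lemma pbw_span_UNIV: "f \<in> pbw_span"
proof (induction f rule: free_alg_induct)
  case (scalar c)
  have "scalar c * pbw (0, 0, 0) \<in> pbw_span" by (intro pbw_span.scalar pbw_span.pbw)
  then show ?case by (simp add: pbw_def)
next
  case (gen v f)
  then show ?case by (cases v) (auto intro: pbw_span_x pbw_span_y pbw_span_z)
qed (rule pbw_span.add)

lemma pbw_normal_form:
  obtains B c where "finite B" "f - (\<Sum>t\<in>B. scalar (c t) * pbw t) \<in> H_ideal p q"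
proof -
  have "\<exists>B c. finite B \<and> f - (\<Sum>t\<in>B. scalar (c t) * pbw t) \<in> H_ideal p q"
    using pbw_span_UNIV[of f]
  proof induction
    case (pbw t)
    show ?case by (rule exI[of _ "{t}"], rule exI[of _ "\<lambda>_. 1"]) simp
  next
    case (add f g)
    then obtain A a B b where A: "finite A" "f - (\<Sum>t\<in>A. scalar (a t) * pbw t) \<in> H_ideal p q"
      and B: "finite B" "g - (\<Sum>t\<in>B. scalar (b t) * pbw t) \<in> H_ideal p q" by blast
    define c where "c t = (if t \<in> A then a t else 0) + (if t \<in> B then b t else 0)" for t
    have "(\<Sum>t\<in>A \<union> B. scalar (c t) * pbw t)
      = (\<Sum>t\<in>A \<union> B. if t \<in> A then scalar (a t) * pbw t else 0)
        + (\<Sum>t\<in>A \<union> B. if t \<in> B then scalar (b t) * pbw t else 0)"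
      unfolding sum.distrib[symmetric]
      by (rule sum.cong) (auto simp: c_def scalar_add distrib_right)
    also have "\<dots> = (\<Sum>t\<in>A. scalar (a t) * pbw t) + (\<Sum>t\<in>B. scalar (b t) * pbw t)"
      using A(1) B(1) by (simp add: sum.inter_restrict[symmetric] Int_absorb1)
    finally have "f + g - (\<Sum>t\<in>A \<union> B. scalar (c t) * pbw t)
      = (f - (\<Sum>t\<in>A. scalar (a t) * pbw t)) + (g - (\<Sum>t\<in>B. scalar (b t) * pbw t))"
      by simp
    then have "f + g - (\<Sum>t\<in>A \<union> B. scalar (c t) * pbw t) \<in> H_ideal p q"
      using H_ideal_add[OF A(2) B(2)] by (simp only:)
    moreover have "finite (A \<union> B)" using A(1) B(1) by simp
    ultimately show ?case by blast
  next
    case (scalar f d)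
    then obtain B c where B: "finite B" "f - (\<Sum>t\<in>B. scalar (c t) * pbw t) \<in> H_ideal p q" by blast
    from H_ideal_mult(1)[OF B(2), of "scalar d"]
    have "scalar d * f - (\<Sum>t\<in>B. scalar (d * c t) * pbw t) \<in> H_ideal p q"
      by (simp add: right_diff_distrib sum_distrib_left scalar_mult mult.assoc)
    then show ?case using B(1) by (intro exI[of _ B] exI[of _ "\<lambda>t. d * c t"]) simp
  next
    case (congr f g)
    then obtain B c where B: "finite B" "f - (\<Sum>t\<in>B. scalar (c t) * pbw t) \<in> H_ideal p q" by blast
    from H_ideal_diff[OF B(2) congr(2)] have "g - (\<Sum>t\<in>B. scalar (c t) * pbw t) \<in> H_ideal p q"
      by simp
    then show ?case using B(1) by blast
  qed
  then show ?thesis using that by blast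
qed

end

section \<open>Leading coefficients in the generic representation\<close>

lemma coeff_prod_linear_factors:
  fixes u v :: "nat \<Rightarrow> 'a::comm_ring_1"
  assumes "k \<le> j"
  shows "Polynomial.coeff (\<Prod>s<k. pCons (u s) (pCons (v s) 0)) j = (if j = k then \<Prod>s<k. v s else 0)"
  using assms
proof (induction k arbitrary: j)
  case 0
  then show ?case by (simp add: coeff_pCons one_pCons split: nat.split)
next
  case (Suc k)
  then obtain j' where j: "j = Suc j'" by (cases j) auto
  have "(\<Prod>s<Suc k. pCons (u s) (pCons (v s) 0))
      = pCons (u k) (pCons (v k) 0) * (\<Prod>s<k. pCons (u s) (pCons (v s) 0))"
    by (simp add: mult.commute)
  then have "Polynomial.coeff (\<Prod>s<Suc k. pCons (u s) (pCons (v s) 0)) j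
      = u k * Polynomial.coeff (\<Prod>s<k. pCons (u s) (pCons (v s) 0)) j
        + v k * Polynomial.coeff (\<Prod>s<k. pCons (u s) (pCons (v s) 0)) j'"
    by (simp add: j del: prod.lessThan_Suc)
  then show ?case using Suc.prems j Suc.IH[of j] Suc.IH[of j'] by (simp add: mult.commute)
qed

lemma const_poly_power: "pCons c 0 ^ n = pCons (c ^ n :: 'a::comm_semiring_1) 0"
  by (induction n) (auto simp: one_pCons mult.commute)

lemma const_poly_prod: "(\<Prod>s\<in>B. pCons (c s) 0) = pCons (\<Prod>s\<in>B. c s :: 'a::comm_semiring_1) 0"
  by (induction B rule: infinite_finite_induct) (auto simp: one_pCons mult.commute)

context H_params
begin

text \<open>The ring \<open>k[S,Z,D]\<close> is modelled by nested univariate polynomials, with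
  \<open>S\<close> innermost and \<open>D\<close> outermost.\<close>

definition gen_h :: "'k \<Rightarrow> 'k poly poly poly"
  where "gen_h c = pCons (pCons (pCons c 0) 0) 0"

definition gen_S :: "'k poly poly poly"
  where "gen_S = pCons (pCons (Polynomial.monom 1 1) 0) 0"

definition gen_Z :: "'k poly poly poly"
  where "gen_Z = pCons (Polynomial.monom 1 1) 0"

definition gen_D :: "'k poly poly poly"
  where "gen_D = Polynomial.monom 1 1"

sublocale generic: H_rep p q l gen_h gen_S gen_Z gen_D
  by unfold_locales (auto simp: gen_h_def one_pCons)

text \<open>The monomial \<open>x\<^sup>i z\<^sup>j y\<^sup>k\<close> acts on the first basis vector with leading term
  \<open>S\<^sup>i\<^sup>+\<^sup>j Z\<^sup>j D\<^sup>k\<close>, where \<open>D\<close> is the outermost variable, up to a nonzero constant.\<close>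

definition lead :: "nat \<times> nat \<times> nat \<Rightarrow> 'k poly poly poly \<Rightarrow> 'k"
  where "lead = (\<lambda>(i, j, k) P. Polynomial.coeff (Polynomial.coeff (Polynomial.coeff P k) j) (i + j))"

lemma lead_add: "lead t (P + Q) = lead t P + lead t Q"
  by (simp add: lead_def split: prod.split)

lemma lead_0: "lead t 0 = 0"
  by (simp add: lead_def split: prod.split)

lemma lead_sum: "lead t (sum P B) = (\<Sum>b\<in>B. lead t (P b))"
  by (induction B rule: infinite_finite_induct) (auto simp: lead_add lead_0)

lemma lead_h_mult: "lead t (gen_h c * P) = c * lead t P"
  by (simp add: lead_def gen_h_def split: prod.split)

text \<open>The exponents \<open>i + j\<close>, \<open>j\<close>, \<open>k\<close> determine the
  triple. The bound on \<open>k\<close> excludes monomials whose lower terms in \<open>D\<close>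
  could interfere.\<close>

lemma lead_pbw:
  assumes "k \<le> k'"
  shows "lead (i', j', k') (\<Sum>a<l. generic.rep (pbw (i, j, k)) a 0)
    = (if (i, j, k) = (i', j', k') then p ^ (k * j) * (\<Prod>s<k. iq ^ s) else 0)"
proof -
  \<comment> \<open>As a polynomial in \<open>D\<close> the weight is linear with leading
    coefficient the constant \<open>iq ^ s\<close>, so the product of \<open>k\<close> weights has
    top term a nonzero multiple of \<open>D ^ k\<close>.\<close>
  have y_weight_neg: "generic.y_weight_neg s = pCons (Polynomial.monom (pCons ((iq ^ s - p ^ s) / (q - ip)) 0) 1)
      (pCons (pCons (pCons (iq ^ s) 0) 0) 0)" for s
    unfolding generic.y_weight_neg_def by (simp add: gen_h_def gen_D_def gen_Z_def monom_Suc monom_0 one_pCons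
        del: generic.h_power generic.h_mult generic.h_diff)
  define m :: "nat \<Rightarrow> 'k poly" where "m = Polynomial.monom 1"
  have m: "Polynomial.monom 1 (Suc 0) ^ n = m n" for n
    by (simp add: m_def monom_power)
  have m2: "Polynomial.monom (1 :: 'k poly) (Suc 0) ^ n = Polynomial.monom 1 n" for n
    by (simp add: monom_power)
  have "(\<Sum>a<l. generic.rep (pbw (i, j, k)) a 0)
    = pCons (Polynomial.smult (m i * (pCons (p ^ (k * j)) 0 * m j)) (Polynomial.monom 1 j)) 0
      * (\<Prod>s<k. generic.y_weight_neg s)"
    unfolding pbw_def prod.case generic.rep_monomial_sum
    by (simp add: gen_S_def gen_Z_def gen_h_def const_poly_power power_mult_distrib smult_power m m2 ac_simps
        del: generic.h_power generic.h_mult)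
  then have "Polynomial.coeff (\<Sum>a<l. generic.rep (pbw (i, j, k)) a 0) k'
    = (if k' = k then Polynomial.smult (m i * (pCons (p ^ (k * j)) 0 * m j)) (Polynomial.monom 1 j)
        * pCons (pCons (\<Prod>s<k. iq ^ s) 0) 0 else 0)"
    by (simp add: y_weight_neg coeff_prod_linear_factors[OF assms] const_poly_prod
        mult.commute[of "prod ((^) iq) {..<k}"])
  moreover have "m i * m j = m (i + j)" by (simp add: m_def mult_monom)
  ultimately show ?thesis
    by (auto simp: lead_def m_def mult.left_commute smult_monom mult_monom)
qed

lemma generic_rep_faithful:
  assumes f: "\<And>i j. i < l \<Longrightarrow> j < l \<Longrightarrow> generic.rep f i j = 0"
  shows "f \<in> H_ideal p q"
proof -
  obtain B c where B: "finite B" "f - (\<Sum>t\<in>B. scalar (c t) * pbw t) \<in> H_ideal p q"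
    using pbw_normal_form .
  define A where "A = {t \<in> B. c t \<noteq> 0}"
  have A: "finite A" "\<And>t. t \<in> A \<Longrightarrow> c t \<noteq> 0" using B by (auto simp: A_def)
  have AB: "(\<Sum>t\<in>B. scalar (c t) * pbw t) = (\<Sum>t\<in>A. scalar (c t) * pbw t)"
    by (rule sum.mono_neutral_right) (use B in \<open>auto simp: A_def\<close>)
  have rep0: "(\<Sum>t\<in>A. gen_h (c t) * generic.rep (pbw t) i 0) = 0" if "i < l" for i
  proof -
    have "generic.rep (f - (\<Sum>t\<in>A. scalar (c t) * pbw t)) i 0 = 0"
      using B(2) generic.H_ideal_subset_kernel that l0 unfolding AB
      by (auto simp: generic.rep_kernel_def simp del: generic.rep_diff)
    then show ?thesis using f[OF that l0] that by (simp add: generic.rep_scalar_mult)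
  qed
  have sum0: "(\<Sum>t\<in>A. gen_h (c t) * (\<Sum>a<l. generic.rep (pbw t) a 0)) = 0"
    by (simp add: sum_distrib_left sum.swap[of _ "{..<l}"] rep0)
  have "A = {}"
  proof (rule ccontr)
    assume "A \<noteq> {}"
    \<comment> \<open>Among the monomials present, one with the highest power of \<open>y\<close> is
      chosen; its coefficient is then isolated by \<open>lead\<close>.\<close>
    define K where "K = Max ((\<lambda>(i, j, k). k) ` A)"
    have "K \<in> (\<lambda>(i, j, k). k) ` A" unfolding K_def using A \<open>A \<noteq> {}\<close> by (intro Max_in) auto
    then obtain i j where ij: "(i, j, K) \<in> A" by auto
    have le: "k' \<le> K" if "(i', j', k') \<in> A" for i' j' k'
      unfolding K_def using A that by (intro Max_ge) force+
    have "0 = lead (i, j, K) (\<Sum>t\<in>A. gen_h (c t) * (\<Sum>a<l. generic.rep (pbw t) a 0))"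
      by (simp add: sum0 lead_0)
    also have "\<dots> = (\<Sum>t\<in>A. if t = (i, j, K) then c t * (p ^ (K * j) * (\<Prod>s<K. iq ^ s)) else 0)"
      unfolding lead_sum[where B = A] lead_h_mult
    proof (rule sum.cong[OF refl])
      fix t assume "t \<in> A"
      obtain i' j' k' where t: "t = (i', j', k')" by (cases t)
      show "c t * lead (i, j, K) (\<Sum>a<l. generic.rep (pbw t) a 0)
        = (if t = (i, j, K) then c t * (p ^ (K * j) * (\<Prod>s<K. iq ^ s)) else 0)"
        unfolding t using le[of i' j' k'] \<open>t \<in> A\<close> t by (subst lead_pbw) auto
    qed
    also have "\<dots> = c (i, j, K) * (p ^ (K * j) * (\<Prod>s<K. iq ^ s))"
      using A ij by simp
    also have "\<dots> \<noteq> 0" using A(2)[OF ij] p0 q0 by simp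
    finally show False by simp
  qed
  then show ?thesis using B(2) by (simp add: AB)
qed

end

section \<open>Standard polynomials\<close>

text \<open>The counterpart of \<open>nc_eval\<close> on representatives in the free algebra, which
  turns identities of the quotient into membership in the ideal.\<close>

definition nc_subst :: "(nat \<Rightarrow> 'a::ring_1) \<Rightarrow> nc_poly \<Rightarrow> 'a"
  where "nc_subst r f = (\<Sum>w\<in>Poly_Mapping.keys f.
    of_int (Poly_Mapping.lookup f w) * prod_list (map r (letters w)))"

lemma nc_subst_add: "nc_subst r (f + g) = nc_subst r f + nc_subst r g"
  unfolding nc_subst_def by (rule setsum_keys_plus_distrib) (simp_all add: distrib_right)

lemma nc_subst_single: "nc_subst r (Poly_Mapping.single w c) = of_int c * prod_list (map r (letters w))"
  by (cases "c = 0") (auto simp: nc_subst_def)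

lemma nc_subst_sum: "nc_subst r (sum f B) = (\<Sum>b\<in>B. nc_subst r (f b))"
  by (induction B rule: infinite_finite_induct) (simp_all add: nc_subst_add, simp_all add: nc_subst_def)

lemma nc_eval_quotient:
  fixes r :: "nat \<Rightarrow> 'a::ring_1"
  assumes "ideal I (ring_of_type_algebra :: 'a ring)"
  shows "nc_eval (ring_of_type_algebra Quot I) (\<lambda>n. I +>\<^bsub>ring_of_type_algebra\<^esub> r n) f
    = I +>\<^bsub>ring_of_type_algebra\<^esub> nc_subst r f"
proof -
  define R :: "'a ring" where "R = ring_of_type_algebra"
  define Q where "Q = R Quot I"
  interpret I: ideal I R using assms by (simp add: R_def)
  interpret Q: ring Q unfolding Q_def by (rule I.quotient_is_ring)
  define \<phi> where "\<phi> a = I +>\<^bsub>R\<^esub> a" for a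
  have R: "carrier R = UNIV" "x \<oplus>\<^bsub>R\<^esub> y = x + y" "x \<otimes>\<^bsub>R\<^esub> y = x * y" "\<one>\<^bsub>R\<^esub> = 1" "\<zero>\<^bsub>R\<^esub> = 0" for x y
    by (simp_all add: R_def ring_of_type_algebra_def)
  interpret \<phi>: ring_hom_ring R Q \<phi>
    using I.rcos_ring_hom_ring unfolding \<phi>_def Q_def .
  have closed: "\<phi> x \<in> carrier Q" for x using \<phi>.hom_closed[of x] by (simp add: R)
  have add: "\<phi> (x + y) = \<phi> x \<oplus>\<^bsub>Q\<^esub> \<phi> y" for x y using \<phi>.hom_add[of x y] by (simp add: R)
  have uminus: "\<phi> (- x) = \<ominus>\<^bsub>Q\<^esub> \<phi> x" for x
    using add[of "- x" x] \<phi>.hom_zero by (intro Q.minus_equality[symmetric]) (simp_all add: closed R)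
  have word: "foldr (\<otimes>\<^bsub>Q\<^esub>) (map (\<lambda>n. \<phi> (r n)) ws) \<one>\<^bsub>Q\<^esub> = \<phi> (prod_list (map r ws))" for ws
  proof (induction ws)
    case Nil
    then show ?case using \<phi>.hom_one by (simp add: R)
  next
    case (Cons v ws)
    then show ?case using \<phi>.hom_mult[of "r v" "prod_list (map r ws)"] by (simp add: R)
  qed
  have npow: "[n] \<cdot>\<^bsub>Q\<^esub> \<phi> x = \<phi> (of_nat n * x)" for n :: nat and x
  proof (induction n)
    case 0
    then show ?case using \<phi>.hom_zero Q.add.nat_pow_0 by (simp add: R)
  next
    case (Suc n)
    have "[Suc n] \<cdot>\<^bsub>Q\<^esub> \<phi> x = [n] \<cdot>\<^bsub>Q\<^esub> \<phi> x \<oplus>\<^bsub>Q\<^esub> \<phi> x" by (rule Q.add.nat_pow_Suc)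
    also have "\<dots> = \<phi> (of_nat n * x + x)" using Suc add by simp
    finally show ?case by (simp add: algebra_simps)
  qed
  have ipow: "[k] \<cdot>\<^bsub>Q\<^esub> \<phi> x = \<phi> (of_int k * x)" for k :: int and x
  proof (cases "k \<ge> 0")
    case True
    then show ?thesis using npow[of "nat k" x] by (simp add: add_pow_int_ge of_nat_nat)
  next
    case False
    then have "[k] \<cdot>\<^bsub>Q\<^esub> \<phi> x = \<phi> (- (of_nat (nat (- k)) * x))"
      by (simp only: add_pow_int_lt not_le npow uminus)
    also have "of_nat (nat (- k)) = (- of_int k :: 'a)" using False by (simp add: of_nat_nat)
    finally show ?thesis by simp
  qed
  have fsum: "(\<Oplus>\<^bsub>Q\<^esub>w\<in>B. \<phi> (g w)) = \<phi> (\<Sum>w\<in>B. g w)" if "finite B" for B :: "nat free_word set" and g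
    using that
  proof induction
    case empty
    then show ?case using \<phi>.hom_zero by (simp add: R)
  next
    case (insert w B)
    then show ?case by (simp add: Q.finsum_insert closed add)
  qed
  have "nc_eval Q (\<lambda>n. \<phi> (r n)) f = \<phi> (nc_subst r f)"
    unfolding nc_eval_def word ipow nc_subst_def by (rule fsum) simp
  then show ?thesis by (simp add: Q_def \<phi>_def R_def)
qed

lemma poly_identity_H_alg_iff:
  fixes p q :: "'k::field"
  shows "poly_identity (H_alg p q) f \<longleftrightarrow> (\<forall>r. nc_subst r f \<in> H_ideal p q)"
proof -
  define R :: "(xyz, 'k) free_alg ring" where "R = ring_of_type_algebra"
  let ?I = "H_ideal p q"
  interpret I: ideal ?I R unfolding R_def by (rule ideal_H_ideal)
  have H: "H_alg p q = R Quot ?I" by (simp add: H_alg_def H_ideal_def R_def)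
  have carr: "carrier R = UNIV" by (simp add: R_def ring_of_type_algebra_def)
  have carrier: "carrier (R Quot ?I) = range (\<lambda>x. ?I +>\<^bsub>R\<^esub> x)"
    by (auto simp: FactRing_def A_RCOSETS_def' carr)
  have zero: "?I +>\<^bsub>R\<^esub> x = \<zero>\<^bsub>R Quot ?I\<^esub> \<longleftrightarrow> x \<in> ?I" for x
    using I.rcos_const_imp_mem[of x] I.a_rcos_const[of x] by (auto simp: FactRing_def carr)
  show ?thesis
  proof
    assume id: "poly_identity (H_alg p q) f"
    show "\<forall>r. nc_subst r f \<in> ?I"
    proof
      fix r :: "nat \<Rightarrow> (xyz, 'k) free_alg"
      have "nc_eval (R Quot ?I) (\<lambda>n. ?I +>\<^bsub>R\<^esub> r n) f = \<zero>\<^bsub>R Quot ?I\<^esub>"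
        using id[unfolded poly_identity_def H, THEN spec, of "\<lambda>n. ?I +>\<^bsub>R\<^esub> r n"]
        by (simp add: carrier)
      then show "nc_subst r f \<in> ?I"
        using nc_eval_quotient[OF ideal_H_ideal, of p q r f] zero by (simp add: R_def)
    qed
  next
    assume nc_subst: "\<forall>r. nc_subst r f \<in> ?I"
    show "poly_identity (H_alg p q) f"
      unfolding poly_identity_def H
    proof (intro allI impI)
      fix a :: "nat \<Rightarrow> _" assume "\<forall>n. a n \<in> carrier (R Quot ?I)"
      then have "\<forall>n. \<exists>x. a n = ?I +>\<^bsub>R\<^esub> x" unfolding carrier by (simp add: image_iff)
      from choice[OF this] obtain r where "\<forall>n. a n = ?I +>\<^bsub>R\<^esub> r n" ..
      then have "a = (\<lambda>n. ?I +>\<^bsub>R\<^esub> r n)" by (intro ext) simp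
      then show "nc_eval (R Quot ?I) a f = \<zero>\<^bsub>R Quot ?I\<^esub>"
        using nc_eval_quotient[OF ideal_H_ideal, of p q r f] zero nc_subst by (simp add: R_def)
    qed
  qed
qed

section \<open>The standard polynomial as a monic identity\<close>

definition std_poly :: "nat \<Rightarrow> nc_poly"
  where "std_poly N = (\<Sum>\<tau> | \<tau> permutes {..<N}. Poly_Mapping.single (Word (map \<tau> [0..<N])) (sign \<tau>))"

text \<open>Only the identity permutation produces this word, so nothing cancels.\<close>

lemma lookup_std_poly_id: "Poly_Mapping.lookup (std_poly N) (Word [0..<N]) = 1"
proof -
  have eq: "map \<tau> [0..<N] = [0..<N] \<longleftrightarrow> \<tau> = id" if "\<tau> permutes {..<N}" for \<tau>
  proof
    assume m: "map \<tau> [0..<N] = [0..<N]"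
    have "\<tau> a = a" for a
    proof (cases "a < N")
      case True
      then show ?thesis using arg_cong[OF m, of "\<lambda>xs. xs ! a"] by simp
    next
      case False
      then show ?thesis using permutes_not_in[OF that] by simp
    qed
    then show "\<tau> = id" by auto
  qed simp
  have "Poly_Mapping.lookup (std_poly N) (Word [0..<N])
      = (\<Sum>\<tau> | \<tau> permutes {..<N}. if \<tau> = id then sign \<tau> else 0)"
    unfolding std_poly_def lookup_sum
    by (rule sum.cong) (auto simp: lookup_single when_def eq)
  also have "\<dots> = 1" by (simp add: finite_permutations permutes_id)
  finally show ?thesis .
qed

lemma letters_keys_std_poly: "w \<in> Poly_Mapping.keys (std_poly N) \<Longrightarrow> length (letters w) = N"
  using keys_sum[of "\<lambda>\<tau>. Poly_Mapping.single (Word (map \<tau> [0..<N])) (sign \<tau>)" "{\<tau>. \<tau> permutes {..<N}}"]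
  by (auto simp: std_poly_def)

lemma nc_degree_std_poly: "nc_degree (std_poly N) = N"
proof -
  have "Word [0..<N] \<in> Poly_Mapping.keys (std_poly N)"
    by (simp add: in_keys_iff lookup_std_poly_id)
  then have "(\<lambda>w. length (letters w)) ` Poly_Mapping.keys (std_poly N) = {N}"
    using letters_keys_std_poly by (auto simp: image_iff)
  then show ?thesis by (simp add: nc_degree_def)
qed

lemma nc_monic_std_poly: "nc_monic (std_poly N)"
  unfolding nc_monic_def nc_degree_std_poly
  by (rule exI[of _ "Word [0..<N]"]) (simp add: lookup_std_poly_id)

lemma (in matrix_rep) rep_of_int_mult: "i < l \<Longrightarrow> rep (of_int k * f) i j = of_int k * rep f i j"
proof -
  assume i: "i < l"
  have nat: "rep (of_nat n * f) i j = of_nat n * rep f i j" for n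
    by (induction n) (auto simp: distrib_right)
  show ?thesis
    using nat by (cases k rule: int_cases2) simp_all
qed

lemma (in matrix_rep) rep_std_poly:
  assumes "i < l" "j < l"
  shows "rep (nc_subst r (std_poly (2 * l))) i j = 0"
  using amitsur_levitzki[OF assms, of "\<lambda>a. rep (r a)"] assms
  by (simp add: std_poly_def nc_subst_sum nc_subst_single rep_of_int_mult rep_prod_list o_def)

text \<open>Every value vanishes in the generic representation by Amitsur-Levitzki, and that
  representation is faithful.\<close>

lemma (in H_params) std_poly_identity: "poly_identity (H_alg p q) (std_poly (2 * l))"
  unfolding poly_identity_H_alg_iff
  by (intro allI generic_rep_faithful generic.rep_std_poly)

section \<open>Polarization and the lower bound\<close>

text \<open>Adding or removing a fixed element of \<open>U\<close> outside \<open>A\<close> pairs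
  the sets with opposite signs.\<close>

lemma alternating_sum_supersets:
  assumes "finite U" "A \<subseteq> U"
  shows "(\<Sum>S | A \<subseteq> S \<and> S \<subseteq> U. (-1) ^ card S) = (if A = U then (-1) ^ card U else 0 :: int)"
proof (cases "A = U")
  case True
  then have "{S. A \<subseteq> S \<and> S \<subseteq> U} = {U}" by auto
  then show ?thesis using True by simp
next
  case False
  then obtain u where u: "u \<in> U" "u \<notin> A" using assms by blast
  define T where "T S = (if u \<in> S then S - {u} else insert u S)" for S
  have fin: "finite S" if "S \<subseteq> U" for S using finite_subset[OF that assms(1)] .
  have "(-1) ^ card (T S) = - ((-1) ^ card S :: int)" if S: "S \<subseteq> U" for S
  proof (cases "u \<in> S")
    case True
    then have "card S = Suc (card (T S))"
      unfolding T_def using card_Suc_Diff1[OF fin[OF S] True] by simp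
    then show ?thesis by simp
  next
    case False
    then show ?thesis using fin[OF S] by (simp add: T_def)
  qed
  then have "(\<Sum>S | A \<subseteq> S \<and> S \<subseteq> U. - ((-1) ^ card S))
      = (\<Sum>S | A \<subseteq> S \<and> S \<subseteq> U. (-1) ^ card S :: int)"
    by (intro sum.reindex_bij_witness[of _ T T]) (use u in \<open>auto simp: T_def\<close>)
  then show ?thesis using False by (simp add: sum_negf)
qed

context
  fixes W :: "nat list" and t :: "nat \<Rightarrow> 'a::ring_1"
begin

text \<open>\<open>W\<close> will be a word of top degree with coefficient 1. Giving each position
  its own element \<open>t j\<close> makes repeated letters of \<open>W\<close>
  distinguishable.\<close>

definition polar_subst :: "nat set \<Rightarrow> nat \<Rightarrow> 'a"
  where "polar_subst S v = (\<Sum>j | j \<in> S \<and> W ! j = v. t j)"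

definition fibre_words :: "nat set \<Rightarrow> nat list \<Rightarrow> nat list set"
  where "fibre_words S V = {g. set g \<subseteq> S \<and> map ((!) W) g = V}"

lemma finite_fibre_words: "finite S \<Longrightarrow> finite (fibre_words S V)"
  by (rule finite_subset[OF _ finite_lists_length_eq[of S "length V"]])
    (auto simp: fibre_words_def dest: map_eq_imp_length_eq)

lemma prod_list_polar_subst:
  assumes "finite S"
  shows "prod_list (map (polar_subst S) V) = (\<Sum>g\<in>fibre_words S V. prod_list (map t g))"
proof (induction V)
  case Nil
  have "fibre_words S [] = {[]}" by (auto simp: fibre_words_def)
  then show ?case by simp
next
  case (Cons v V)
  let ?J = "{j. j \<in> S \<and> W ! j = v}"
  have "prod_list (map (polar_subst S) (v # V))
      = (\<Sum>(j, g)\<in>?J \<times> fibre_words S V. prod_list (map t (j # g)))"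
    unfolding list.map prod_list.Cons Cons polar_subst_def[of S v] sum_product
    by (simp add: sum.cartesian_product)
  also have "\<dots> = (\<Sum>g\<in>fibre_words S (v # V). prod_list (map t g))"
    by (rule sum.reindex_bij_witness[of _ "\<lambda>g. (hd g, tl g)" "\<lambda>(j, g). j # g"])
      (auto simp: fibre_words_def map_eq_Cons_conv)
  finally show ?case .
qed

text \<open>Inclusion-exclusion over the sets \<open>S\<close> of variables extracts the part of a word that
  involves all of the elements \<open>t j\<close>.\<close>

lemma polarization:
  assumes U: "finite U"
  shows "(\<Sum>S\<in>Pow U. of_int ((-1) ^ card S) * prod_list (map (polar_subst S) V))
    = of_int ((-1) ^ card U) * (\<Sum>g | g \<in> fibre_words U V \<and> set g = U. prod_list (map t g))"
proof -
  have fin: "finite S" if "S \<in> Pow U" for S using that U finite_subset by auto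
  have "(\<Sum>S\<in>Pow U. of_int ((-1) ^ card S) * prod_list (map (polar_subst S) V))
      = (\<Sum>S\<in>Pow U. \<Sum>g\<in>fibre_words U V. if set g \<subseteq> S then of_int ((-1) ^ card S) * prod_list (map t g) else 0)"
  proof (rule sum.cong[OF refl])
    fix S assume S: "S \<in> Pow U"
    have eq: "fibre_words S V = {g \<in> fibre_words U V. set g \<subseteq> S}"
      using S by (auto simp: fibre_words_def)
    show "of_int ((-1) ^ card S) * prod_list (map (polar_subst S) V)
      = (\<Sum>g\<in>fibre_words U V. if set g \<subseteq> S then of_int ((-1) ^ card S) * prod_list (map t g) else 0)"
      unfolding prod_list_polar_subst[OF fin[OF S]] sum_distrib_left eq
      by (rule sum.inter_filter[OF finite_fibre_words[OF U]])
  qed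
  also have "\<dots> = (\<Sum>g\<in>fibre_words U V. \<Sum>S\<in>Pow U. if set g \<subseteq> S then of_int ((-1) ^ card S) * prod_list (map t g) else 0)"
    by (rule sum.swap)
  also have "\<dots> = (\<Sum>g\<in>fibre_words U V. if set g = U then of_int ((-1) ^ card U) * prod_list (map t g) else 0)"
  proof (rule sum.cong[OF refl])
    fix g assume g: "g \<in> fibre_words U V"
    have "(\<Sum>S\<in>Pow U. if set g \<subseteq> S then of_int ((-1) ^ card S) * prod_list (map t g) else 0)
      = (\<Sum>S | set g \<subseteq> S \<and> S \<subseteq> U. of_int ((-1) ^ card S) * prod_list (map t g))"
    proof -
      have eq: "{S. set g \<subseteq> S \<and> S \<subseteq> U} = {S \<in> Pow U. set g \<subseteq> S}" by auto
      show ?thesis unfolding eq using U by (intro sum.inter_filter[symmetric]) simp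
    qed
    also have "\<dots> = of_int (\<Sum>S | set g \<subseteq> S \<and> S \<subseteq> U. (-1) ^ card S) * prod_list (map t g)"
      by (simp add: sum_distrib_right)
    also have "\<dots> = (if set g = U then of_int ((-1) ^ card U) * prod_list (map t g) else 0)"
      using g by (subst alternating_sum_supersets[OF U]) (auto simp: fibre_words_def)
    finally show "(\<Sum>S\<in>Pow U. if set g \<subseteq> S then of_int ((-1) ^ card S) * prod_list (map t g) else 0)
      = (if set g = U then of_int ((-1) ^ card U) * prod_list (map t g) else 0)" .
  qed
  also have "\<dots> = of_int ((-1) ^ card U) * (\<Sum>g | g \<in> fibre_words U V \<and> set g = U. prod_list (map t g))"
    using finite_fibre_words[OF U] by (simp add: sum.inter_filter[symmetric] sum_distrib_left)
  finally show ?thesis .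
qed

end

text \<open>The matrices \<open>M j\<close> are the staircase \<open>E\<^sub>0\<^sub>0, E\<^sub>0\<^sub>1, E\<^sub>1\<^sub>1, E\<^sub>1\<^sub>2, \<dots>\<close> up to a scalar; among
  the products of distinct ones only those in increasing order do not vanish.\<close>

context
  fixes n d :: nat and M :: "nat \<Rightarrow> nat \<Rightarrow> nat \<Rightarrow> 'c::comm_ring_1" and \<gamma> :: 'c
  assumes d: "d < 2 * n"
    and M: "\<And>j a b. j < d \<Longrightarrow> a < n \<Longrightarrow> b < n \<Longrightarrow>
      M j a b = (if a = j div 2 \<and> b = Suc j div 2 then \<gamma> else 0)"
begin

lemma staircase_Cons:
  assumes "j < d" "a < n"
  shows "mat_prod n (map M (j # g)) a b = (if a = j div 2 then \<gamma> * mat_prod n (map M g) (Suc j div 2) b else 0)"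
proof -
  have lt: "Suc j div 2 < n" using assms d by linarith
  have "mat_prod n (map M (j # g)) a b
      = (\<Sum>k<n. if k = Suc j div 2 then (if a = j div 2 then \<gamma> * mat_prod n (map M g) k b else 0) else 0)"
    unfolding list.map mat_prod_Cons mat_mul_def by (rule sum.cong) (use assms in \<open>auto simp: M\<close>)
  then show ?thesis using lt by simp
qed

text \<open>In a nonzero product the column of each factor is the row of the next, so rows never
  decrease. The bound by \<open>a\<close> carries this through the induction.\<close>

lemma staircase_nonzero_imp_sorted:
  assumes "set g \<subseteq> {..<d}" "a < n" "mat_prod n (map M g) a b \<noteq> 0"
  shows "sorted g \<and> (\<forall>j\<in>set g. a \<le> j div 2)"
  using assms
proof (induction g arbitrary: a)
  case (Cons j g)
  have j: "j < d" using Cons.prems by simp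
  have lt: "Suc j div 2 < n" using j d by linarith
  have a: "a = j div 2" and nz: "mat_prod n (map M g) (Suc j div 2) b \<noteq> 0"
    using Cons.prems(3) unfolding staircase_Cons[OF j Cons.prems(2)] by (auto split: if_splits)
  have IH: "sorted g" "\<forall>i\<in>set g. Suc j div 2 \<le> i div 2"
    using Cons.IH[OF _ lt nz] Cons.prems(1) by auto
  have "j \<le> i" if "i \<in> set g" for i
    using bspec[OF IH(2) that] by presburger
  moreover have "a \<le> i div 2" if "i \<in> set g" for i
    using bspec[OF IH(2) that] a by presburger
  ultimately show ?case using IH(1) a by auto
qed simp

lemma staircase_increasing:
  "s \<le> d \<Longrightarrow> mat_prod n (map M [s..<d]) (s div 2) (d div 2) = \<gamma> ^ (d - s)"
proof (induction "d - s" arbitrary: s)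
  case 0
  then show ?case by (simp add: mat_one_def)
next
  case (Suc k)
  then have s: "s < d" by simp
  then have "s div 2 < n" using d by linarith
  then have "mat_prod n (map M [s..<d]) (s div 2) (d div 2) = \<gamma> * mat_prod n (map M [Suc s..<d]) (Suc s div 2) (d div 2)"
    using s by (simp add: upt_conv_Cons staircase_Cons del: mat_prod_Cons list.map)
  also have "\<dots> = \<gamma> ^ Suc (d - Suc s)" using Suc by simp
  finally show ?case using s by (simp add: Suc_diff_Suc)
qed

lemma staircase_permuted:
  assumes "set g = {..<d}" "length g \<le> d"
  shows "mat_prod n (map M g) 0 (d div 2) = (if g = [0..<d] then \<gamma> ^ d else 0)"
proof (cases "mat_prod n (map M g) 0 (d div 2) = 0")
  case True
  then show ?thesis using staircase_increasing[of 0] by auto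
next
  case False
  then have "sorted g" using staircase_nonzero_imp_sorted[of g 0] assms(1) d by auto
  \<comment> \<open>All \<open>d\<close> elements must fit into at most \<open>d\<close>
    places.\<close>
  moreover have "distinct g"
    using assms by (metis card_distinct card_lessThan card_length le_antisym)
  ultimately have "g = [0..<d]"
    using assms(1) by (intro sorted_distinct_set_unique) (auto simp: lessThan_atLeast0)
  then show ?thesis using staircase_increasing[of 0] by simp
qed

end

lemma length_le_nc_degree: "w \<in> Poly_Mapping.keys f \<Longrightarrow> length (letters w) \<le> nc_degree f"
  unfolding nc_degree_def by (intro Max_ge) auto

text \<open>The alternating sum of the substitutions \<open>polar_subst\<close> leaves position
  words using every position. Of these the staircase keeps only the increasing one, which spells
  only the chosen top word, and the result is \<open>\<gamma> ^ d\<close> up to sign.\<close>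

lemma (in matrix_rep) no_small_identity:
  assumes monic: "nc_monic f" and deg: "nc_degree f < 2 * l"
    and t: "\<And>j a b. j < nc_degree f \<Longrightarrow> a < l \<Longrightarrow> b < l \<Longrightarrow>
      rep (t j) a b = (if a = j div 2 \<and> b = Suc j div 2 then \<gamma> else 0)"
    and \<gamma>: "\<gamma> ^ nc_degree f \<noteq> 0"
  shows "\<exists>r. nc_subst r f \<notin> rep_kernel"
proof (rule ccontr)
  assume "\<nexists>r. nc_subst r f \<notin> rep_kernel"
  then have ker: "nc_subst r f \<in> rep_kernel" for r by blast
  define d where "d = nc_degree f"
  obtain w0 where w0: "length (letters w0) = d" "Poly_Mapping.lookup f w0 = 1"
    using monic by (auto simp: nc_monic_def d_def)
  define W where "W = letters w0"
  define U where "U = {..<d}"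
  have finU: "finite U" by (simp add: U_def)
  \<comment> \<open>The product of \<open>d\<close> staircase matrices in order sits in row
    \<open>0\<close> and column \<open>d div 2\<close>, which must lie inside the matrix.\<close>
  have dl: "0 < l" "d div 2 < l" using deg by (auto simp: d_def)
  note ker0 = ker[unfolded rep_kernel_def mem_Collect_eq, rule_format, OF dl]
  define F where "F V = {g. g \<in> fibre_words W U V \<and> set g = U}" for V
  have "(\<Sum>S\<in>Pow U. of_int ((-1) ^ card S) * nc_subst (polar_subst W t S) f)
    = (\<Sum>w\<in>Poly_Mapping.keys f. of_int (Poly_Mapping.lookup f w) *
        (\<Sum>S\<in>Pow U. of_int ((-1) ^ card S) * prod_list (map (polar_subst W t S) (letters w))))"
    unfolding nc_subst_def sum_distrib_left
    by (subst sum.swap) (simp add: mult.assoc[symmetric] of_int_mult[symmetric] mult.commute[of "(-1) ^ _"]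
      del: of_int_mult of_int_power)
  also have "\<dots> = (\<Sum>w\<in>Poly_Mapping.keys f. of_int (Poly_Mapping.lookup f w * (-1) ^ d) *
        (\<Sum>g\<in>F (letters w). prod_list (map t g)))"
    unfolding polarization[OF finU] by (simp add: U_def F_def mult.assoc)
  finally have expansion: "(\<Sum>S\<in>Pow U. of_int ((-1) ^ card S) * nc_subst (polar_subst W t S) f)
    = (\<Sum>w\<in>Poly_Mapping.keys f. of_int (Poly_Mapping.lookup f w * (-1) ^ d) *
        (\<Sum>g\<in>F (letters w). prod_list (map t g)))" .
  have "0 = rep (\<Sum>w\<in>Poly_Mapping.keys f. of_int (Poly_Mapping.lookup f w * (-1) ^ d) *
        (\<Sum>g\<in>F (letters w). prod_list (map t g))) 0 (d div 2)"
    unfolding expansion[symmetric]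
    by (simp only: rep_sum rep_of_int_mult[OF dl(1)] ker0 mult_zero_right sum.neutral_const)
  also have "\<dots> = (\<Sum>w\<in>Poly_Mapping.keys f. of_int (Poly_Mapping.lookup f w * (-1) ^ d) *
        (\<Sum>g\<in>F (letters w). if g = [0..<d] then \<gamma> ^ d else 0))"
  proof -
    have "rep (prod_list (map t g)) 0 (d div 2) = (if g = [0..<d] then \<gamma> ^ d else 0)"
      if "w \<in> Poly_Mapping.keys f" "g \<in> F (letters w)" for w g
    proof -
      have g: "map ((!) W) g = letters w" "set g = {..<d}"
        using that(2) by (auto simp: F_def fibre_words_def U_def)
      have len: "length g \<le> d"
        using length_le_nc_degree[OF that(1)] unfolding d_def g(1)[symmetric] by simp
      have "rep (prod_list (map t g)) 0 (d div 2) = mat_prod l (map (\<lambda>j. rep (t j)) g) 0 (d div 2)"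
        using rep_prod_list[OF dl, of "map t g"] by (simp add: o_def)
      also have "\<dots> = (if g = [0..<d] then \<gamma> ^ d else 0)"
        by (rule staircase_permuted[OF _ _ g(2) len]) (use t deg in \<open>auto simp: d_def\<close>)
      finally show ?thesis .
    qed
    then show ?thesis
      unfolding rep_sum rep_of_int_mult[OF dl(1)] by (simp cong: sum.cong)
  qed
  also have "\<dots> = (\<Sum>w\<in>Poly_Mapping.keys f. if w = w0 then (-1) ^ d * \<gamma> ^ d else 0)"
  proof (rule sum.cong[OF refl])
    fix w assume "w \<in> Poly_Mapping.keys f"
    have fin: "finite (F V)" for V
      using finite_fibre_words[of U W V] by (simp add: F_def U_def)
    have "map ((!) W) [0..<d] = W" using w0(1) map_nth[of W] by (simp add: W_def)
    moreover have "W = letters w \<longleftrightarrow> w = w0"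
      unfolding W_def using free_word.expand by blast
    ultimately have mem: "[0..<d] \<in> F (letters w) \<longleftrightarrow> w = w0"
      by (simp add: F_def fibre_words_def U_def lessThan_atLeast0)
    show "of_int (Poly_Mapping.lookup f w * (-1) ^ d) * (\<Sum>g\<in>F (letters w). if g = [0..<d] then \<gamma> ^ d else 0)
      = (if w = w0 then (-1) ^ d * \<gamma> ^ d else 0)"
      using fin mem w0 by (simp add: sum.delta)
  qed
  also have "\<dots> = (-1) ^ d * \<gamma> ^ d" using w0 by (simp add: in_keys_iff)
  finally show False using \<gamma> by (cases "even d") (simp_all add: d_def)
qed

section \<open>Multiples of all matrix units in the special representation\<close>

locale H_roots = H_params p q "lcm m n"
  for p q :: "'k::field" and m n :: nat +
  assumes pprim: "primitive_root_of_unity m p" and qprim: "primitive_root_of_unity n q"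
begin

abbreviation l :: nat where "l \<equiv> lcm m n"

text \<open>Named, because interpreting the locale with a bare \<open>\<lambda>c. c\<close> would turn the simplification rules
  for homomorphisms into loops.\<close>

definition trivial_hom :: "'k \<Rightarrow> 'k"
  where "trivial_hom c = c"

sublocale special: H_rep p q l trivial_hom 1 1 0
  by unfold_locales (auto simp: trivial_hom_def)

lemma special_y_weight: "special.y_weight i = qnum i"
  using trivial_hom_def[of "qnum i"] by (simp add: special.y_weight_def)

lemma special_gen_mat_z: "special.gen_mat Gz a b = (if a = b then ip ^ b else 0)"
  using trivial_hom_def[of ip] by (simp add: special.gen_mat_def)

lemma special_rep_scalar: "special.rep (scalar c) i j = c * mat_one i j"
  using special.rep_scalar[of c i j] trivial_hom_def[of c] by simp

lemma special_rep_scalar_mult: "i < l \<Longrightarrow> special.rep (scalar c * f) i j = c * special.rep f i j"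
  using special.rep_scalar_mult[of i c f j] trivial_hom_def[of c] by simp

lemma rep_x_power:
  "a < l \<Longrightarrow> b < l \<Longrightarrow> special.rep (gen Gx ^ i) a b = (if a = (b + i) mod l then 1 else 0)"
proof (induction i arbitrary: a)
  case 0
  then show ?case by (simp add: special.rep_1 mat_one_def)
next
  case (Suc i)
  have "special.rep (gen Gx ^ Suc i) a b = special.rep (gen Gx ^ i) (pred_mod a) b"
    using Suc.prems by (simp add: special.rep_x_mult)
  also have "\<dots> = (if pred_mod a = (b + i) mod l then 1 else 0)"
    using Suc pred_mod_less by simp
  also have "pred_mod a = (b + i) mod l \<longleftrightarrow> a = (b + Suc i) mod l"
    using eq_Suc_mod_iff[of a "(b + i) mod l"] Suc.prems(1) l0 by (auto simp: mod_Suc_eq)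
  finally show ?case .
qed

definition diagonal :: "(xyz, 'k) free_alg \<Rightarrow> (nat \<Rightarrow> 'k) \<Rightarrow> bool"
  where "diagonal f \<phi> \<longleftrightarrow> (\<forall>a<l. \<forall>b<l. special.rep f a b = (if a = b then \<phi> a else 0))"

lemma diagonal_mult_rep:
  assumes "diagonal f \<phi>" "a < l" "b < l"
  shows "special.rep (f * g) a b = \<phi> a * special.rep g a b"
proof -
  have "special.rep (f * g) a b = (\<Sum>k<l. if k = a then \<phi> a * special.rep g a b else 0)"
    unfolding special.rep_mult[OF assms(2)] mat_mul_def
    by (rule sum.cong) (use assms in \<open>auto simp: diagonal_def\<close>)
  then show ?thesis using assms by simp
qed

lemma diagonal_mult: "diagonal f \<phi> \<Longrightarrow> diagonal g \<psi> \<Longrightarrow> diagonal (f * g) (\<lambda>a. \<phi> a * \<psi> a)"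
  using diagonal_mult_rep[of f \<phi>] by (simp add: diagonal_def)

lemma diagonal_minus_scalar: "diagonal f \<phi> \<Longrightarrow> diagonal (f - scalar c) (\<lambda>a. \<phi> a - c)"
  by (simp add: diagonal_def special_rep_scalar mat_one_def)

lemma diagonal_prod_list:
  "(\<And>c. diagonal (f c) (\<phi> c)) \<Longrightarrow> diagonal (prod_list (map f cs)) (\<lambda>a. prod_list (map (\<lambda>c. \<phi> c a) cs))"
  by (induction cs) (simp_all add: diagonal_mult, simp add: diagonal_def special.rep_1 mat_one_def)

text \<open>The normal element that, like \<open>z\<close>, acts diagonally.\<close>

definition u :: "(xyz, 'k) free_alg"
  where "u = gen Gy * gen Gx - scalar ip * (gen Gx * gen Gy)"

lemma diagonal_z: "diagonal (gen Gz) (\<lambda>a. ip ^ a)"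
  by (simp add: diagonal_def special.rep_gen special_gen_mat_z)

text \<open>On \<open>v\<^sub>a\<close> the products \<open>yx\<close> and \<open>xy\<close> act by
  \<open>qnum (Suc a)\<close> and \<open>qnum a\<close>, and the second recursion leaves
  \<open>q ^ a\<close>.\<close>

lemma diagonal_u: "diagonal u (\<lambda>a. q ^ a)"
  unfolding diagonal_def
proof (intro allI impI)
  fix a b assume ab: "a < l" "b < l"
  have "special.rep (gen Gy * gen Gx) a b = (if a = b then qnum (Suc a) else 0)"
    using ab l0 eq_Suc_mod_iff[of "Suc a mod l" b] pred_mod_Suc[of a]
    by (auto simp: special.rep_y_mult special.rep_gen special.gen_mat_def special_y_weight)
  moreover have "special.rep (gen Gx * gen Gy) a b = (if a = b then qnum a else 0)"
    using ab pred_mod_less[of a] Suc_pred_mod[of a]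
    by (auto simp: special.rep_x_mult special.rep_gen special.gen_mat_def special_y_weight)
  ultimately show "special.rep u a b = (if a = b then q ^ a else 0)"
    using ab by (simp add: u_def special_rep_scalar_mult qnum_Suc')
qed

text \<open>Every diagonal entry except the first is killed by one of the factors, since
  \<open>(q\<^sup>a, p\<^sup>-\<^sup>a) \<noteq> (1, 1)\<close> for \<open>0 < a < l\<close>.\<close>

definition corner :: "(xyz, 'k) free_alg"
  where "corner = prod_list (map (\<lambda>j. u - scalar (q ^ j)) [1..<n])
    * prod_list (map (\<lambda>j. gen Gz - scalar (ip ^ j)) [1..<m])"

definition corner_val :: 'k
  where "corner_val = prod_list (map (\<lambda>j. 1 - q ^ j) [1..<n]) * prod_list (map (\<lambda>j. 1 - ip ^ j) [1..<m])"

lemma corner_val_nonzero: "corner_val \<noteq> 0"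
proof -
  have "q ^ j \<noteq> 1" if "1 \<le> j" "j < n" for j
    using qprim that by (auto simp: primitive_root_of_unity_def)
  moreover have "ip ^ j \<noteq> 1" if "1 \<le> j" "j < m" for j
    using pprim that by (auto simp: primitive_root_of_unity_def power_inverse)
  ultimately show ?thesis by (auto simp: corner_val_def prod_list_zero_iff)
qed

lemma power_mod_root:
  "c ^ j = 1 \<Longrightarrow> c ^ (i mod j) = (c :: 'k) ^ i"
  by (metis mod_mult_div_eq mult.right_neutral power_add power_mult power_one)

lemma diagonal_corner: "diagonal corner (\<lambda>a. if a = 0 then corner_val else 0)"
proof -
  define \<phi> where "\<phi> a = prod_list (map (\<lambda>j. q ^ a - q ^ j) [1..<n]) * prod_list (map (\<lambda>j. ip ^ a - ip ^ j) [1..<m])" for a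
  have "diagonal corner \<phi>"
    unfolding corner_def \<phi>_def
    by (intro diagonal_mult diagonal_prod_list diagonal_minus_scalar diagonal_u diagonal_z)
  moreover have "\<phi> a = (if a = 0 then corner_val else 0)" if "a < l" for a
  proof (cases "a = 0")
    case True
    then show ?thesis by (simp add: \<phi>_def corner_val_def)
  next
    case False
    have "\<not> l dvd a" using that False by (intro nat_dvd_not_less) simp_all
    then consider "\<not> n dvd a" | "\<not> m dvd a" using lcm_least by blast
    then have "\<phi> a = 0"
    proof cases
      case 1
      have n: "n > 0" "q ^ n = 1" using qprim by (auto simp: primitive_root_of_unity_def)
      \<comment> \<open>The residue of \<open>a\<close> indexes the factor that vanishes.\<close>
      have "a mod n \<in> set [1..<n]" using 1 n by (auto simp: mod_greater_zero_iff_not_dvd Suc_le_eq)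
      moreover have "q ^ a - q ^ (a mod n) = 0" using power_mod_root[OF n(2)] by simp
      ultimately have "0 \<in> set (map (\<lambda>j. q ^ a - q ^ j) [1..<n])" by force
      then have "prod_list (map (\<lambda>j. q ^ a - q ^ j) [1..<n]) = 0" by (simp only: prod_list_zero_iff)
      then show ?thesis by (simp add: \<phi>_def)
    next
      case 2
      have m: "m > 0" "ip ^ m = 1" using pprim by (auto simp: primitive_root_of_unity_def power_inverse)
      have "a mod m \<in> set [1..<m]" using 2 m by (auto simp: mod_greater_zero_iff_not_dvd Suc_le_eq)
      moreover have "ip ^ a - ip ^ (a mod m) = 0" using power_mod_root[OF m(2)] by simp
      ultimately have "0 \<in> set (map (\<lambda>j. ip ^ a - ip ^ j) [1..<m])" by force
      then have "prod_list (map (\<lambda>j. ip ^ a - ip ^ j) [1..<m]) = 0" by (simp only: prod_list_zero_iff)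
      then show ?thesis by (simp add: \<phi>_def)
    qed
    then show ?thesis using False by simp
  qed
  ultimately show ?thesis by (simp add: diagonal_def)
qed

text \<open>The power \<open>l - j\<close> of \<open>x\<close> carries \<open>v\<^sub>j\<close> to
  \<open>v\<^sub>0\<close>, \<open>corner\<close> keeps only \<open>v\<^sub>0\<close>, and the power
  \<open>i\<close> carries it to \<open>v\<^sub>i\<close>.\<close>

definition matrix_unit :: "nat \<Rightarrow> nat \<Rightarrow> (xyz, 'k) free_alg"
  where "matrix_unit i j = gen Gx ^ i * (corner * gen Gx ^ (l - j))"

lemma rep_matrix_unit:
  assumes "i < l" "j < l" "a < l" "b < l"
  shows "special.rep (matrix_unit i j) a b = (if a = i \<and> b = j then corner_val else 0)"
proof -
  have j: "0 = (b + (l - j)) mod l \<longleftrightarrow> b = j"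
    using add_mod_right_cancel_less[of b l j "l - j"] assms by auto
  have "special.rep (matrix_unit i j) a b
      = (\<Sum>k<l. if k = 0 then (if a = i \<and> b = j then corner_val else 0) else 0)"
    unfolding matrix_unit_def special.rep_mult[OF assms(3)] mat_mul_def
  proof (rule sum.cong[OF refl])
    fix k assume "k \<in> {..<l}"
    then show "special.rep (gen Gx ^ i) a k * special.rep (corner * gen Gx ^ (l - j)) k b
      = (if k = 0 then if a = i \<and> b = j then corner_val else 0 else 0)"
      using assms j by (auto simp: diagonal_mult_rep[OF diagonal_corner] rep_x_power)
  qed
  then show ?thesis using l0 by simp
qed

lemma identity_degree_ge:
  assumes "nc_monic f" "poly_identity (H_alg p q) f"
  shows "2 * l \<le> nc_degree f"
proof (rule ccontr)
  assume "\<not> 2 * l \<le> nc_degree f"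
  then have deg: "nc_degree f < 2 * l" by simp
  have "\<exists>r. nc_subst r f \<notin> special.rep_kernel"
  proof (rule special.no_small_identity[OF assms(1) deg])
    fix j a b assume "j < nc_degree f" "a < l" "b < l"
    moreover have "j div 2 < l" "Suc j div 2 < l" using \<open>j < nc_degree f\<close> deg by linarith+
    ultimately show "special.rep (matrix_unit (j div 2) (Suc j div 2)) a b
      = (if a = j div 2 \<and> b = Suc j div 2 then corner_val else 0)"
      by (intro rep_matrix_unit)
  qed (simp add: corner_val_nonzero)
  then show False
    using assms(2) special.H_ideal_subset_kernel unfolding poly_identity_H_alg_iff by blast
qed

lemma PI_degree_H_alg: "PI_degree (H_alg p q) = of_nat l"
proof -
  have "min_degree (H_alg p q) = 2 * l"
    unfolding min_degree_def
  proof (rule Least_equality)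
    show "\<exists>f. nc_monic f \<and> poly_identity (H_alg p q) f \<and> nc_degree f = 2 * l"
      using nc_monic_std_poly std_poly_identity nc_degree_std_poly by blast
  qed (use identity_degree_ge in blast)
  moreover have "PI_ring (H_alg p q)"
    unfolding PI_ring_def using nc_monic_std_poly std_poly_identity by blast
  ultimately show ?thesis by (simp add: PI_degree_def)
qed

end

theorem theorem3p1:
  fixes p q :: "'k::field" and m n :: nat
  assumes "p \<noteq> 0" and "q \<noteq> 0" and "p * q \<noteq> 1"
    and "primitive_root_of_unity m p" and "primitive_root_of_unity n q"
  shows "PI_degree (H_alg p q) = of_nat (lcm m n)"
proof -
  have pos: "m > 0" "n > 0" and root: "p ^ m = 1" "q ^ n = 1"
    using assms(4,5) by (auto simp: primitive_root_of_unity_def)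
  have "p ^ lcm m n = 1" "q ^ lcm m n = 1"
    using root by (metis dvdE dvd_lcm1 power_mult power_one, metis dvdE dvd_lcm2 power_mult power_one)
  then interpret H_roots p q m n
    using assms pos by unfold_locales (auto simp: lcm_pos_nat)
  show ?thesis by (rule PI_degree_H_alg)
qed

end
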